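(* Let $\alpha\in(1,2]$, $\sigma>0$, $u>0$, $S>0$, $K>0$, $r\in\mathbb{R}$, $\tau>0$, let $X_t\sim L(0,\sigma^\alpha,-1)$, and put $\mu=\sigma^\alpha/\cos\frac{\pi\alpha}{2}$ and $k_u:=\log\frac{S}{K^{1/u}}+r\tau$. The value of the European power call option, i.e. the option with payoff $\mathcal{P}^{(E)}(S_T,K)=[S_T^u-K]^+$, is $$C_\alpha^{(E)}(S,K,r,\mu,\tau)=\frac{K e^{-r\tau}}{\alpha}\sum_{n=0}^\infty\sum_{m=1}^\infty\frac{1}{n!\,\Gamma\left(1+\frac{m-n}{\alpha}\right)}\,u^m\,(k_u+\mu\tau)^n\,(-\mu\tau)^{\frac{m-n}{\alpha}}.$$
   Context: The process $X_t\sim L(0,\sigma^\alpha,-1)$ is the spectrally negative $\alpha$-stable Lévy process with characteristic function $\mathbb{E}[e^{ikX_t}]=\exp\left(-t\,\sigma^\alpha|k|^\alpha\left(1+i\tan\frac{\alpha\pi}{2}\,\mathrm{sgn}\,k\right)\right)$ for $k\in\mathbb{R}$; equivalently $\mathbb{E}[e^{pX_t}]=e^{-\mu t p^\alpha}$ for $p>0$, with $\mu=\sigma^\alpha/\cos\frac{\pi\alpha}{2}<0$. The asset price at maturity is $S_T=S\,e^{(r+\mu)\tau+X_\tau}$, where $\tau$ is the time-to-maturity, and the value of an option with payoff $\mathcal{P}(S_T,K)$ is $e^{-r\tau}\,\mathbb{E}\left[\mathcal{P}\left(Se^{(r+\mu)\tau+X_\tau},K\right)\right]$. Notation: $X^+:=X\mathbf{1}_{\{X>0\}}$.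 Conventions: $1/\Gamma(z)=0$ when $z$ is a non-positive integer, and $0^0=1$. *)

theory Defs
  imports "HOL-Probability.Probability"
begin

text \<open>
  Processes are indexed by real times, of which only times \<open>t \<ge> 0\<close> matter. A Levy process
  is a process started at 0 with independent and stationary increments that is stochastically
  continuous. Cadlag paths are not required, so versions with and without this regularity are
  both covered.
\<close>

definition independent_increments :: "'a measure \<Rightarrow> (real \<Rightarrow> 'a \<Rightarrow> real) \<Rightarrow> bool" where
  "independent_increments M X \<longleftrightarrow>
     (\<forall>n. \<forall>t :: nat \<Rightarrow> real. 0 \<le> t 0 \<and> (\<forall>i<n. t i \<le> t (Suc i)) \<longrightarrow>
        prob_space.indep_vars M (\<lambda>_. borel) (\<lambda>i \<omega>. X (t (Suc i)) \<omega> - X (t i) \<omega>) {..<n})"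

definition stationary_increments :: "'a measure \<Rightarrow> (real \<Rightarrow> 'a \<Rightarrow> real) \<Rightarrow> bool" where
  "stationary_increments M X \<longleftrightarrow>
     (\<forall>s\<ge>0. \<forall>h\<ge>0. distr M borel (\<lambda>\<omega>. X (s + h) \<omega> - X s \<omega>) = distr M borel (X h))"

definition stochastically_continuous :: "'a measure \<Rightarrow> (real \<Rightarrow> 'a \<Rightarrow> real) \<Rightarrow> bool" where
  "stochastically_continuous M X \<longleftrightarrow>
     (\<forall>s\<ge>0. \<forall>\<epsilon>>0.
        ((\<lambda>t. measure M {\<omega> \<in> space M. \<bar>X t \<omega> - X s \<omega>\<bar> > \<epsilon>}) \<longlongrightarrow> 0) (at s within {0..}))"

definition levy_process :: "'a measure \<Rightarrow> (real \<Rightarrow> 'a \<Rightarrow> real) \<Rightarrow> bool" where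
  "levy_process M X \<longleftrightarrow>
     prob_space M \<and>
     (\<forall>t\<ge>0. X t \<in> borel_measurable M) \<and>
     (AE \<omega> in M. X 0 \<omega> = 0) \<and>
     independent_increments M X \<and>
     stationary_increments M X \<and>
     stochastically_continuous M X"

text \<open>
  \<open>X t \<sim> L(0, \<sigma>^\<alpha>, -1)\<close>: the parametrization is fixed by the characteristic function.
\<close>

definition spectrally_negative_stable ::
  "'a measure \<Rightarrow> (real \<Rightarrow> 'a \<Rightarrow> real) \<Rightarrow> real \<Rightarrow> real \<Rightarrow> bool" where
  "spectrally_negative_stable M X \<alpha> \<sigma> \<longleftrightarrow>
     levy_process M X \<and>
     (\<forall>t\<ge>0. \<forall>k.
        char (distr M borel (X t)) k =
          exp (- complex_of_real (t * \<sigma> powr \<alpha> * \<bar>k\<bar> powr \<alpha>)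
                 * (1 + \<i> * complex_of_real (tan (\<alpha> * pi / 2) * sgn k))))"

definition asset_price ::
  "(real \<Rightarrow> 'a \<Rightarrow> real) \<Rightarrow> real \<Rightarrow> real \<Rightarrow> real \<Rightarrow> real \<Rightarrow> 'a \<Rightarrow> real" where
  "asset_price X S r \<mu> \<tau> \<omega> = S * exp ((r + \<mu>) * \<tau> + X \<tau> \<omega>)"

definition option_value ::
  "'a measure \<Rightarrow> (real \<Rightarrow> 'a \<Rightarrow> real) \<Rightarrow> (real \<Rightarrow> real \<Rightarrow> real) \<Rightarrow>
   real \<Rightarrow> real \<Rightarrow> real \<Rightarrow> real \<Rightarrow> real \<Rightarrow> real" where
  "option_value M X payoff S K r \<mu> \<tau> =
     exp (- r * \<tau>) * (LINT \<omega>|M. payoff (asset_price X S r \<mu> \<tau> \<omega>) K)"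

definition positive_part :: "real \<Rightarrow> real" where
  "positive_part x = x * indicator {0<..} x"

definition power_call_payoff :: "real \<Rightarrow> real \<Rightarrow> real \<Rightarrow> real" where
  "power_call_payoff u s K = positive_part (s powr u - K)"

text \<open>
  \<open>rGamma\<close> is the entire function \<open>1/\<Gamma>\<close>, which vanishes at the non-positive integers.
\<close>

definition power_call_term ::
  "real \<Rightarrow> real \<Rightarrow> real \<Rightarrow> real \<Rightarrow> real \<Rightarrow> nat \<Rightarrow> nat \<Rightarrow> real" where
  "power_call_term \<alpha> u \<mu> \<tau> k n m =
     1 / fact n * rGamma (1 + (real m - real n) / \<alpha>)
       * u ^ m * (k + \<mu> * \<tau>) ^ n * (- \<mu> * \<tau>) powr ((real m - real n) / \<alpha>)"

end

theory Submission
  imports Defs "HOL-Complex_Analysis.Complex_Analysis" "HOL-Real_Asymp.Real_Asymp"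
begin

text \<open>
  With \<open>a = - \<mu> \<tau> > 0\<close> and \<open>Y = k\<^sub>u + \<mu> \<tau> + X\<^sub>\<tau>\<close> the payoff is \<open>K (exp (u Y) - 1)\<close> on \<open>{Y > 0}\<close>, and on the
  imaginary axis the characteristic function of \<open>Y\<close> is \<open>exp (z s + a s\<^sup>\<alpha>)\<close> with \<open>z = k\<^sub>u + \<mu> \<tau>\<close>. Levy inversion gives, for
  \<open>\<theta> > 0\<close>, the bounded moment \<open>E[exp (- \<theta> Y); Y > 0]\<close> as the integral of \<open>exp (z s + a s\<^sup>\<alpha>) / (\<theta> + s)\<close>
  along the imaginary axis. Shifting to \<open>Re s = q > \<theta>\<close> allows both \<open>exp (z s)\<close> and
  \<open>1 / (\<theta> + s)\<close> to be expanded; the resulting integrals of \<open>s\<^sup>n\<^sup>-\<^sup>m\<^sup>-\<^sup>1 exp (a s\<^sup>\<alpha>)\<close> are values of the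
  reciprocal Gamma function. So the moment is an entire power series in \<open>- \<theta>\<close>. Its Taylor coefficients at
  \<open>- 1\<close> are nonnegative, so by monotone convergence the series also represents
  \<open>E[exp (u Y); Y > 0]\<close> for \<open>u \<ge> 0\<close>; no exponential moment of \<open>X\<^sub>\<tau>\<close> has to be known in advance.
  The term \<open>m = 0\<close> is \<open>P(Y > 0)\<close>, which is why the sum of the theorem starts at \<open>m = 1\<close>.
\<close>

section \<open>Exponential moments from the Laplace transform\<close>

text \<open>Levy inversion yields masses of intervals, hence moments of bounded weights only, while
  \<open>exp (u y)\<close> is unbounded. A power series argument with nonnegative coefficients, as
  in Landau's theorem on Laplace integrals, bridges the gap; its centre must lie inside the
  half-line where the moment is known to be finite, and - 1 is such a point.

  The imaginary axis cannot carry the expansion itself: 1 / (\<theta> + s) expands in powers of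
  \<theta> / s only for |s| > \<theta>, and negative integral powers of s are not integrable at 0.
  On Re s = q one has |s| \<ge> q > \<theta>. The shift needs control of exp (a s^\<alpha>) in a
  strip: cos (pi \<alpha> / 2) < 0 gives decay like exp of a negative multiple of |Im s|^\<alpha>,
  and \<alpha> > 1 lets this beat every exp (A |Im s|), which pays for exp (z s) and for all powers
  of s.

  The coefficients do not depend on q, so q may exceed any prescribed |w|. This makes the series
  entire and gives a product bound v n * r^m. The expansion has n inside and m outside, the theorem
  the reverse; the bound permits the exchange.\<close>

lemma real_power_series_unique:
  fixes b c :: "nat \<Rightarrow> real"
  assumes "0 < r"
    and b: "\<And>x. \<bar>x\<bar> < r \<Longrightarrow> (\<lambda>n. b n * x ^ n) sums f x"
    and c: "\<And>x. \<bar>x\<bar> < r \<Longrightarrow> (\<lambda>n. c n * x ^ n) sums f x"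
  shows "b = c"
proof (rule ext, rule ccontr)
  fix m assume m: "b m \<noteq> c m"
  have s: "(\<lambda>n. (b n - c n) * (x - 0) ^ n) sums 0" if "norm (x - 0) < r" for x
    using sums_diff[OF b[of x] c[of x]] that by (simp add: algebra_simps)
  have "b 0 = c 0"
    using s[of 0] \<open>0 < r\<close> by (simp add: powser_sums_zero_iff)
  with m have "m > 0" by (cases m) auto
  \<comment> \<open>The sum is constantly 0, yet \<open>powser_0_nonzero\<close> makes it nonzero on
    a punctured ball, which contains the point \<open>e\<close> itself. That fact wants a nonzero
    coefficient of positive index, hence the separate look at index 0.\<close>
  with powser_0_nonzero[of r 0 "\<lambda>n. b n - c n" "\<lambda>_. 0" m] s \<open>0 < r\<close> m
  obtain e where "0 < e" and e: "\<And>z::real. z \<in> cball 0 e - {0} \<Longrightarrow> (0::real) \<noteq> 0"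
    by auto
  then show False using e[of e] by simp
qed

text \<open>Convergence at every real point forces convergence in every complex disc, so the series
  is an entire function, and its Taylor series at any other centre converges everywhere. Real parts
  of the new coefficients suffice because \<open>h\<close> and the sum are real.\<close>

lemma entire_real_power_series_recentre:
  fixes d :: "nat \<Rightarrow> real"
  assumes d: "\<And>w. summable (\<lambda>m. d m * w ^ m)"
  obtains e where "\<And>h. (\<lambda>k. e k * h ^ k) sums (\<Sum>m. d m * (h + x) ^ m)"
proof -
  define g where "g w = (\<Sum>m. complex_of_real (d m) * (w + of_real x) ^ m)" for w :: complex
  have sm: "summable (\<lambda>m. complex_of_real (d m) * w ^ m)" for w :: complex
  proof (rule powser_inside[of _ "of_real (norm w + 1)"])
    show "summable (\<lambda>m. complex_of_real (d m) * of_real (norm w + 1) ^ m)"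
      by (simp only: of_real_power[symmetric] of_real_mult[symmetric] summable_of_real_iff d)
  qed simp
  have hol: "(\<lambda>w. \<Sum>m. complex_of_real (d m) * w ^ m) holomorphic_on UNIV"
  proof (rule holomorphic_onI)
    fix w :: complex
    have "(\<lambda>w. \<Sum>m. complex_of_real (d m) * (w - 0) ^ m) holomorphic_on ball 0 (norm w + 1)"
      by (rule power_series_holomorphic) (use sm in \<open>auto intro!: summable_sums\<close>)
    then show "(\<lambda>w. \<Sum>m. complex_of_real (d m) * w ^ m) field_differentiable at w within UNIV"
      by (auto simp: holomorphic_on_open field_differentiable_def)
  qed
  have "g holomorphic_on UNIV"
  proof -
    have "(\<lambda>w. w + of_real x) holomorphic_on UNIV" by (intro holomorphic_intros)
    from holomorphic_on_compose_gen[OF this hol] show ?thesis by (simp add: o_def g_def[abs_def])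
  qed
  then have g: "(\<lambda>n. (deriv ^^ n) g 0 / (fact n) * (w - 0) ^ n) sums g w" for w
    by (intro holomorphic_power_series[where r = "norm w + 1"])
       (auto intro: holomorphic_on_subset)
  show thesis
  proof
    fix h :: real
    have "g (of_real h) = of_real (\<Sum>m. d m * (h + x) ^ m)"
      unfolding g_def
      by (simp add: suminf_of_real[OF d])
    then have "(\<lambda>n. Re ((deriv ^^ n) g 0 / (fact n) * of_real h ^ n)) sums (\<Sum>m. d m * (h + x) ^ m)"
      using sums_Re[OF g[of "of_real h"]] by simp
    then show "(\<lambda>k. Re ((deriv ^^ k) g 0 / fact k) * h ^ k) sums (\<Sum>m. d m * (h + x) ^ m)"
      by (simp only: of_real_power[symmetric] Re_complex_of_real times_complex.sel Im_complex_of_real) simp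
  qed
qed

text \<open>Near \<theta> = 1 the transform has a Taylor series with nonnegative coefficients
  \<open>b k\<close>; by uniqueness they are those of the entire series recentred at - 1.
  Convergence of that series at \<open>u + 1\<close> then delivers finiteness of the moment together
  with its value.\<close>

lemma exponential_moment_continuation:
  fixes d :: "nat \<Rightarrow> real"
  assumes "real_distribution N"
    and d: "\<And>w. summable (\<lambda>m. d m * w ^ m)"
    and laplace: "\<And>\<theta>. 0 < \<theta> \<Longrightarrow>
      (\<integral>y. exp (- \<theta> * y) * indicator {0<..} y \<partial>N) = (\<Sum>m. d m * (- \<theta>) ^ m)"
    and "0 \<le> u"
  shows "has_bochner_integral N (\<lambda>y. exp (u * y) * indicator {0<..} y) (\<Sum>m. d m * u ^ m)"
proof -
  interpret real_distribution N by fact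
  \<comment> \<open>Taylor terms of exp (- \<theta> y) at \<theta> = 1 in the variable h = 1 -
    \<theta>, up to the factor h^k; the restriction to y > 0 makes them nonnegative.\<close>
  define f where "f k y = y ^ k / fact k * (exp (- y) * indicator {0<..} y)" for k and y :: real
  have [measurable]: "f k \<in> borel_measurable N" for k unfolding f_def by measurable
  have f0: "0 \<le> f k y" for k y
    by (auto simp: f_def indicator_def)
  have fsums: "(\<lambda>k. f k y * h ^ k) sums (exp ((h - 1) * y) * indicator {0<..} y)" for h y
  proof -
    have "(\<lambda>k. (h * y) ^ k /\<^sub>R fact k * (exp (- y) * indicator {0<..} y)) sums
        (exp (h * y) * (exp (- y) * indicator {0<..} y))"
      by (intro sums_mult2 exp_converges)
    also have "exp (h * y) * (exp (- y) * indicator {0<..} y) = exp ((h - 1) * y) * indicator {0<..} y"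
      by (simp add: algebra_simps exp_diff exp_minus field_simps)
    also have "(\<lambda>k. (h * y) ^ k /\<^sub>R fact k * (exp (- y) * indicator {0<..} y)) = (\<lambda>k. f k y * h ^ k)"
      by (auto simp: f_def power_mult_distrib divide_inverse)
    finally show ?thesis .
  qed
  have int_exp: "integrable N (\<lambda>y. exp (c * y) * indicator {0<..} y)" if "c \<le> 0" for c
    by (rule integrable_const_bound[of _ 1])
       (use that in \<open>auto simp: indicator_def mult_le_0_iff\<close>)
  have int_f: "integrable N (f k)" for k
  proof (rule Bochner_Integration.integrable_bound)
    show "integrable N (\<lambda>y. 2 ^ k * (exp ((1 / 2 - 1) * y) * indicator {0<..} y))"
      by (intro integrable_mult_right int_exp) simp
    show "AE y in N. norm (f k y) \<le> norm (2 ^ k * (exp ((1 / 2 - 1) * y) * indicator {0<..} y))"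
    proof (rule AE_I2)
      fix y :: real
      \<comment> \<open>A single nonnegative term is at most the whole sum, here taken at h =
        1/2.\<close>
      have "f k y * (1 / 2) ^ k \<le> exp ((1 / 2 - 1) * y) * indicator {0<..} y"
        using sum_le_suminf[OF sums_summable[OF fsums[of y "1/2"]], of "{k}"] f0
        by (simp add: sums_unique[OF fsums, symmetric])
      then show "norm (f k y) \<le> norm (2 ^ k * (exp ((1 / 2 - 1) * y) * indicator {0<..} y))"
        using f0[of k y] by (simp add: field_simps power_divide)
    qed
  qed simp
  define b where "b k = integral\<^sup>L N (f k)" for k
  have b0: "0 \<le> b k" for k unfolding b_def by (intro Bochner_Integration.integral_nonneg) (rule f0)
  have nn: "(\<integral>\<^sup>+y. ennreal (exp ((h - 1) * y) * indicator {0<..} y) \<partial>N) = (\<Sum>k. ennreal (b k * h ^ k))"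
    if "0 \<le> h" for h
  proof -
    have "(\<integral>\<^sup>+y. ennreal (exp ((h - 1) * y) * indicator {0<..} y) \<partial>N)
        = (\<integral>\<^sup>+y. (\<Sum>k. ennreal (f k y * h ^ k)) \<partial>N)"
    proof (rule nn_integral_cong)
      fix y
      show "ennreal (exp ((h - 1) * y) * indicator {0<..} y) = (\<Sum>k. ennreal (f k y * h ^ k))"
        using that
        by (simp add: suminf_ennreal2[OF _ sums_summable[OF fsums]] f0
            sums_unique[OF fsums, symmetric] del: ennreal_mult')
    qed
    also have "\<dots> = (\<Sum>k. \<integral>\<^sup>+y. ennreal (f k y * h ^ k) \<partial>N)"
      by (intro nn_integral_suminf) simp
    also have "\<dots> = (\<Sum>k. ennreal (b k * h ^ k))"
      unfolding b_def using that f0 int_f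
      by (subst nn_integral_eq_integral) auto
    finally show ?thesis .
  qed
  have bsum: "(\<lambda>k. b k * h ^ k) sums (\<integral>y. exp ((h - 1) * y) * indicator {0<..} y \<partial>N)"
    if h: "\<bar>h\<bar> < 1" for h
  proof -
    let ?F = "\<lambda>k y. f k y * h ^ k"
    \<comment> \<open>The norms of the terms at h are the terms at |h|, so the nonnegative case
      controls both signs.\<close>
    have "(\<Sum>k. ennreal (b k * \<bar>h\<bar> ^ k)) = (\<integral>\<^sup>+y. ennreal (exp ((\<bar>h\<bar> - 1) * y) * indicator {0<..} y) \<partial>N)"
      using nn[of "\<bar>h\<bar>"] by simp
    also have "\<dots> = ennreal (\<integral>y. exp ((\<bar>h\<bar> - 1) * y) * indicator {0<..} y \<partial>N)"
      using int_exp[of "\<bar>h\<bar> - 1"] h by (intro nn_integral_eq_integral) auto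
    finally have "(\<Sum>k. ennreal (b k * \<bar>h\<bar> ^ k)) \<noteq> top" by simp
    then have sm: "summable (\<lambda>k. b k * \<bar>h\<bar> ^ k)"
      by (intro summable_suminf_not_top) (auto simp: b0)
    have "(\<lambda>k. integral\<^sup>L N (?F k)) sums (\<integral>y. (\<Sum>k. ?F k y) \<partial>N)"
    proof (rule sums_integral)
      show "integrable N (?F k)" for k using int_f by simp
      show "AE y in N. summable (\<lambda>k. norm (?F k y))"
        using sums_summable[OF fsums[of _ "\<bar>h\<bar>"]] f0 by (simp add: abs_mult power_abs)
      show "summable (\<lambda>k. \<integral>y. norm (?F k y) \<partial>N)"
        using sm f0 by (simp add: abs_mult power_abs b_def)
    qed
    then show ?thesis
      by (simp add: b_def sums_unique[OF fsums, symmetric])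
  qed
  obtain e where e: "\<And>h. (\<lambda>k. e k * h ^ k) sums (\<Sum>m. d m * (h + (- 1)) ^ m)"
    using entire_real_power_series_recentre[of d, OF d, of "- 1" thesis] by metis
  have "b = e"
  proof (rule real_power_series_unique[of 1])
    show "\<bar>h\<bar> < 1 \<Longrightarrow> (\<lambda>k. b k * h ^ k) sums (\<integral>y. exp ((h - 1) * y) * indicator {0<..} y \<partial>N)" for h
      by (rule bsum)
    show "(\<lambda>k. e k * h ^ k) sums (\<integral>y. exp ((h - 1) * y) * indicator {0<..} y \<partial>N)"
      if "\<bar>h\<bar> < 1" for h
      using e[of h] laplace[of "1 - h"] that by simp
  qed simp
  with e[of "u + 1"] have u: "(\<lambda>k. b k * (u + 1) ^ k) sums (\<Sum>m. d m * u ^ m)" by simp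
  then have "(\<integral>\<^sup>+y. ennreal (exp (u * y) * indicator {0<..} y) \<partial>N) = ennreal (\<Sum>m. d m * u ^ m)"
    using nn[of "u + 1"] \<open>0 \<le> u\<close>
    by (simp add: suminf_ennreal2[OF _ sums_summable[OF u]] b0 sums_unique[OF u, symmetric])
  moreover have "0 \<le> (\<Sum>m. d m * u ^ m)"
    using u b0 \<open>0 \<le> u\<close> by (intro sums_le[OF _ sums_zero u]) simp
  ultimately show ?thesis
    by (intro has_bochner_integral_nn_integral) auto
qed

section \<open>Gamma integrals with complex rate\<close>

text \<open>Substitution t = l * y powr \<alpha> in Euler's integral. With the exponent written
  through \<open>s\<close>, multiplying the integrand by (y powr \<alpha>)^k just replaces s by s +
  k.\<close>

lemma has_bochner_integral_Gamma_powr: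
  fixes s l \<alpha> :: real
  assumes "0 < s" "0 < l" "0 < \<alpha>"
  shows "has_bochner_integral lborel
    (\<lambda>y. indicator {0<..} y * (y powr (\<alpha> * s - 1) * exp (- l * y powr \<alpha>)))
    (Gamma s / (\<alpha> * l powr s))"
proof -
  let ?g = "\<lambda>y. l * y powr \<alpha>" and ?g' = "\<lambda>y. l * (\<alpha> * y powr (\<alpha> - 1))"
  let ?f = "\<lambda>t. t powr (s - 1) / exp t"
  have der: "(?g has_field_derivative ?g' x) (at x within {0<..})" if "x \<in> {0<..}" for x
    using that by (auto intro!: derivative_eq_intros)
  have inj: "inj_on ?g {0<..}"
  proof (rule inj_onI)
    fix x y assume "x \<in> {0<..}" "y \<in> {0<..}" "?g x = ?g y"
    then have "0 < x" "0 < y" "(x powr \<alpha>) powr (1 / \<alpha>) = (y powr \<alpha>) powr (1 / \<alpha>)"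
      using assms by auto
    then show "x = y" using assms by (simp add: powr_powr)
  qed
  have im: "?g ` {0<..} = {0<..}"
  proof (intro equalityI subsetI)
    fix t :: real assume "t \<in> {0<..}"
    then have "?g ((t / l) powr (1 / \<alpha>)) = t" "(t / l) powr (1 / \<alpha>) \<in> {0<..}"
      using assms by (auto simp: powr_powr)
    then show "t \<in> ?g ` {0<..}" by (metis imageI)
  qed (use assms in auto)
  have G: "(?f has_integral Gamma s) {0<..}"
    by (rule iffD1[OF has_integral_spike_set_eq Gamma_integral_real[OF \<open>0 < s\<close>]])
       (auto intro: negligible_subset[OF negligible_sing[of 0]])
  have f: "?f absolutely_integrable_on {0<..}"
    using G by (intro nonnegative_absolutely_integrable_1) auto
  have "(\<lambda>y. \<bar>?g' y\<bar> * ?f (?g y)) absolutely_integrable_on {0<..} \<and>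
      integral {0<..} (\<lambda>y. \<bar>?g' y\<bar> * ?f (?g y)) = Gamma s"
    using has_absolute_integral_change_of_variables_1'[OF _ der inj, of ?f "Gamma s"] f
      integral_unique[OF G] by (simp add: im)
  then have "integrable lborel (\<lambda>y. indicator {0<..} y *\<^sub>R (\<bar>?g' y\<bar> * ?f (?g y)))"
      and "(\<integral>y. indicator {0<..} y *\<^sub>R (\<bar>?g' y\<bar> * ?f (?g y)) \<partial>lborel) = Gamma s"
    by (auto simp: set_integrable_def set_lebesgue_integral_eq_integral(2)[symmetric]
        set_lebesgue_integral_def integrable_completion integral_completion)
  then have "has_bochner_integral lborel
      (\<lambda>y. (1 / (\<alpha> * l powr s)) * (indicator {0<..} y *\<^sub>R (\<bar>?g' y\<bar> * ?f (?g y))))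
      ((1 / (\<alpha> * l powr s)) * Gamma s)"
    by (intro has_bochner_integral_mult_right) (simp add: has_bochner_integral_iff)
  moreover have "(1 / (\<alpha> * l powr s)) * (indicator {0<..} y *\<^sub>R (\<bar>?g' y\<bar> * ?f (?g y)))
      = indicator {0<..} y * (y powr (\<alpha> * s - 1) * exp (- l * y powr \<alpha>))" for y
    using assms
    by (auto simp: indicator_def powr_mult powr_powr exp_minus field_simps powr_diff abs_mult
        simp flip: powr_add)
  ultimately show ?thesis by simp
qed

lemma powr_of_real_mult_left:
  assumes "0 < l"
  shows "(complex_of_real l * w) powr z = complex_of_real l powr z * w powr z"
  using powr_times_real_left[of "of_real l" w z] assms by simp

text \<open>Stands in for a rotation of the contour. Splitting off exp (- l y powr \<alpha>) leaves
  an exponential series, and termwise integration turns it into the binomial series of (1 + \<zeta>)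
  powr - s.\<close>

lemma has_bochner_integral_Gamma_powr_complex:
  fixes \<beta> \<alpha> :: real and \<omega> :: complex
  assumes "0 < \<beta>" "0 < \<alpha>" "0 < Re \<omega>"
  shows "has_bochner_integral lborel
    (\<lambda>y. indicator {0<..} y *\<^sub>R (of_real (y powr (\<beta> - 1)) * exp (- \<omega> * of_real (y powr \<alpha>))))
    (of_real (Gamma (\<beta> / \<alpha>) / \<alpha>) * \<omega> powr (- of_real (\<beta> / \<alpha>)))"
proof -
  define s where "s = \<beta> / \<alpha>"
  define l where "l = (cmod \<omega>)\<^sup>2 / (2 * Re \<omega>) + 1"
  \<comment> \<open>For large real \<open>l\<close> the number \<open>\<omega>\<close> lies in the disc of radius \<open>l\<close> around \<open>l\<close>, so the binomial
    series around the real rate \<open>l\<close>, where the integral is known, converges.\<close>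
  define \<zeta> where "\<zeta> = (\<omega> - of_real l) / of_real l"
  have s: "0 < s" "\<alpha> * s = \<beta>" using assms by (auto simp: s_def)
  have l: "0 < l" using assms by (auto simp: l_def intro!: add_nonneg_pos)
  have "(cmod (\<omega> - of_real l))\<^sup>2 < l\<^sup>2"
  proof -
    have "(cmod (\<omega> - of_real l))\<^sup>2 = (cmod \<omega>)\<^sup>2 - 2 * l * Re \<omega> + l\<^sup>2"
      unfolding cmod_power2 by (simp add: power2_eq_square algebra_simps)
    also have "(cmod \<omega>)\<^sup>2 - 2 * l * Re \<omega> < 0"
      using assms by (simp add: l_def field_simps)
    finally show ?thesis by simp
  qed
  then have "cmod (\<omega> - of_real l) < l" using l by (simp add: power_less_imp_less_base)
  then have \<zeta>: "norm \<zeta> < 1" using l by (simp add: \<zeta>_def norm_divide)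
  have \<omega>_eq: "\<omega> = of_real l * (1 + \<zeta>)" using l by (simp add: \<zeta>_def field_simps)
  define c where "c k = (- (of_real l * \<zeta>)) ^ k / fact k" for k :: nat
  define f where "f k y = c k * of_real (indicator {0<..} y * (y powr (\<alpha> * (s + k) - 1) * exp (- l * y powr \<alpha>)))"
    for k :: nat and y :: real
  define G where "G k = Gamma (s + real k) / (\<alpha> * l powr (s + real k))" for k :: nat
  have hb: "has_bochner_integral lborel
      (\<lambda>y. indicator {0<..} y * (y powr (\<alpha> * (s + k) - 1) * exp (- l * y powr \<alpha>))) (G k)" for k :: nat
    unfolding G_def using s l assms by (intro has_bochner_integral_Gamma_powr) auto
  have Gk: "G k = Gamma s / \<alpha> * l powr - s * (pochhammer s k / l ^ k)" for k
  proof -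
    have "s \<notin> \<int>\<^sub>\<le>\<^sub>0" using s by (auto elim!: nonpos_Ints_cases)
    then have "Gamma (s + real k) = Gamma s * pochhammer s k"
      using pochhammer_Gamma[of s k] Gamma_real_pos[OF s(1)] by simp
    then show ?thesis
      using l by (simp add: G_def powr_add powr_realpow powr_minus divide_inverse)
  qed
  have nc: "norm (c k) = l ^ k * norm \<zeta> ^ k / fact k" for k
    using l by (simp add: c_def norm_divide norm_power norm_mult power_mult_distrib)
  have fsums: "(\<lambda>k. f k y) sums
      (indicator {0<..} y *\<^sub>R (of_real (y powr (\<beta> - 1)) * exp (- \<omega> * of_real (y powr \<alpha>))))" for y
  proof (cases "0 < y")
    case True
    have "(\<lambda>k. (- (of_real l * \<zeta>) * of_real (y powr \<alpha>)) ^ k /\<^sub>R fact k *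
          of_real (y powr (\<beta> - 1) * exp (- l * y powr \<alpha>))) sums
        (exp (- (of_real l * \<zeta>) * of_real (y powr \<alpha>)) * of_real (y powr (\<beta> - 1) * exp (- l * y powr \<alpha>)))"
      by (intro sums_mult2 exp_converges)
    also have "exp (- (of_real l * \<zeta>) * of_real (y powr \<alpha>)) * of_real (y powr (\<beta> - 1) * exp (- l * y powr \<alpha>))
        = indicator {0<..} y *\<^sub>R (of_real (y powr (\<beta> - 1)) * exp (- \<omega> * of_real (y powr \<alpha>)))"
      using True by (simp add: \<omega>_eq exp_add[symmetric] exp_of_real[symmetric] algebra_simps)
    also have "(\<lambda>k. (- (of_real l * \<zeta>) * of_real (y powr \<alpha>)) ^ k /\<^sub>R fact k *
          of_real (y powr (\<beta> - 1) * exp (- l * y powr \<alpha>))) = (\<lambda>k. f k y)"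
    proof
      fix k
      have "y powr (\<alpha> * (s + k) - 1) = y powr (\<beta> - 1) * (y powr \<alpha>) ^ k"
        using True s by (simp add: powr_powr distrib_left algebra_simps
            flip: powr_add powr_realpow)
      then show "(- (of_real l * \<zeta>) * of_real (y powr \<alpha>)) ^ k /\<^sub>R fact k *
          of_real (y powr (\<beta> - 1) * exp (- l * y powr \<alpha>)) = f k y"
        using True by (simp only: f_def c_def power_mult_distrib)
          (simp add: scaleR_conv_of_real divide_inverse)
    qed
    finally show ?thesis .
  qed (simp add: f_def)
  have "(\<lambda>k. integral\<^sup>L lborel (f k)) sums (\<integral>y. (\<Sum>k. f k y) \<partial>lborel)"
    and int: "integrable lborel (\<lambda>y. \<Sum>k. f k y)"
  proof -
    have i: "integrable lborel (f k)" for k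
      unfolding f_def using hb[of k] by (intro integrable_mult_right integrable_of_real) (rule integrable.intros)
    have a: "AE y in lborel. summable (\<lambda>k. norm (f k y))"
    proof (rule AE_I2)
      fix y
      have "(\<lambda>k. norm (c k) * (y powr \<alpha>) ^ k) = (\<lambda>k. (l * norm \<zeta> * y powr \<alpha>) ^ k /\<^sub>R fact k)"
        by (auto simp: nc power_mult_distrib divide_inverse)
      then have "summable (\<lambda>k. norm (c k) * (y powr \<alpha>) ^ k)"
        using summable_exp_generic[of "l * norm \<zeta> * y powr \<alpha>"] by simp
      then have "summable (\<lambda>k. norm (c k) * (y powr \<alpha>) ^ k * (indicator {0<..} y * (y powr (\<beta> - 1) * exp (- l * y powr \<alpha>))))"
        by (rule summable_mult2)
      also have "(\<lambda>k. norm (c k) * (y powr \<alpha>) ^ k * (indicator {0<..} y * (y powr (\<beta> - 1) * exp (- l * y powr \<alpha>))))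
          = (\<lambda>k. norm (f k y))"
      proof
        fix k
        have "y powr (\<alpha> * (s + k) - 1) = y powr (\<beta> - 1) * (y powr \<alpha>) ^ k" if "0 < y"
          using that s by (simp add: powr_powr distrib_left algebra_simps
              flip: powr_add powr_realpow)
        then show "norm (c k) * (y powr \<alpha>) ^ k * (indicator {0<..} y * (y powr (\<beta> - 1) * exp (- l * y powr \<alpha>)))
          = norm (f k y)"
          by (auto simp: f_def norm_mult indicator_def)
      qed
      finally show "summable (\<lambda>k. norm (f k y))" .
    qed
    \<comment> \<open>The generalized binomial coefficient and (- |\<zeta>|)^k carry the same sign,
      so the integrated norms form the binomial series of (1 - |\<zeta>|) powr - s, which
      converges.\<close>
    have "(\<integral>y. norm (f k y) \<partial>lborel) = Gamma s / \<alpha> * l powr - s * ((- s gchoose k) * (- norm \<zeta>) ^ k)" for k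
    proof -
      have "(\<integral>y. norm (f k y) \<partial>lborel) = norm (c k) * G k"
      proof -
        have "norm (f k y) = norm (c k) *
            (indicator {0<..} y * (y powr (\<alpha> * (s + k) - 1) * exp (- l * y powr \<alpha>)))" for y
          by (simp add: f_def norm_mult abs_mult)
        then show ?thesis
          using hb[of k] by (simp only: integral_mult_right_zero has_bochner_integral_integral_eq)
      qed
      also have "\<dots> = Gamma s / \<alpha> * l powr - s * ((- s gchoose k) * (- norm \<zeta>) ^ k)"
      proof -
        have "(- 1) ^ k * (- norm \<zeta>) ^ k = norm \<zeta> ^ k" by (simp flip: power_mult_distrib)
        then show ?thesis unfolding nc Gk gbinomial_pochhammer using l by (simp add: mult_ac flip: \<open>(- 1) ^ k * (- norm \<zeta>) ^ k = norm \<zeta> ^ k\<close>)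
      qed
      finally show ?thesis .
    qed
    moreover have "summable (\<lambda>k. Gamma s / \<alpha> * l powr - s * ((- s gchoose k) * (- norm \<zeta>) ^ k))"
      using gen_binomial_real[of "- norm \<zeta>" "- s"] \<zeta> by (intro summable_mult) (auto simp: sums_iff)
    ultimately have b: "summable (\<lambda>k. \<integral>y. norm (f k y) \<partial>lborel)" by simp
    show "(\<lambda>k. integral\<^sup>L lborel (f k)) sums (\<integral>y. (\<Sum>k. f k y) \<partial>lborel)"
      by (rule sums_integral[OF i a b])
    show "integrable lborel (\<lambda>y. \<Sum>k. f k y)"
      by (rule integrable_suminf[OF i a b])
  qed
  moreover have "(\<lambda>k. integral\<^sup>L lborel (f k)) sums
      (of_real (Gamma (\<beta> / \<alpha>) / \<alpha>) * \<omega> powr (- of_real (\<beta> / \<alpha>)))"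
  proof -
    have "integral\<^sup>L lborel (f k) = of_real (Gamma s / \<alpha> * l powr - s) * ((- of_real s gchoose k) * \<zeta> ^ k)" for k
    proof -
      have "integral\<^sup>L lborel (f k) = c k * of_real (G k)"
        using hb[of k] unfolding f_def
        by (simp only: integral_mult_right_zero integral_complex_of_real has_bochner_integral_integral_eq)
      moreover have "of_real (pochhammer s k) = (pochhammer (of_real s) k :: complex)"
        by (simp add: pochhammer_of_real)
      then have "c k * of_real (G k) = of_real (Gamma s / \<alpha> * l powr - s) * ((- of_real s gchoose k) * \<zeta> ^ k)"
        using l by (simp add: c_def Gk gbinomial_pochhammer power_minus[of "of_real l * \<zeta>"]
            power_mult_distrib) (simp add: mult_ac)
      ultimately show ?thesis by simp
    qed
    moreover have "(\<lambda>k. of_real (Gamma s / \<alpha> * l powr - s) * ((- of_real s gchoose k) * \<zeta> ^ k)) sums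
        (of_real (Gamma s / \<alpha> * l powr - s) * (1 + \<zeta>) powr (- of_real s))"
      by (intro sums_mult gen_binomial_complex \<zeta>)
    moreover have "of_real (Gamma s / \<alpha> * l powr - s) * (1 + \<zeta>) powr (- of_real s)
        = of_real (Gamma (\<beta> / \<alpha>) / \<alpha>) * \<omega> powr (- of_real (\<beta> / \<alpha>))"
      using l unfolding \<omega>_eq powr_of_real_mult_left[OF l] s_def
      by (simp add: powr_of_real[symmetric])
    ultimately show ?thesis by (simp only:)
  qed
  ultimately show ?thesis
    using sums_unique2 unfolding sums_unique[OF fsums, symmetric]
    by (auto simp: has_bochner_integral_iff)
qed

section \<open>The Laplace transform on the positive half-line from the characteristic function\<close>

lemma has_bochner_integral_exp_complex:
  assumes "0 < Re w"
  shows "has_bochner_integral lborel (\<lambda>t. indicator {0<..} t *\<^sub>R exp (- w * of_real t)) (1 / w)"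
proof -
  have "w \<noteq> 0" using assms by auto
  then have "w powr (- 1) = 1 / w" by (simp add: powr_minus divide_inverse)
  moreover have "indicator {0<..} y *\<^sub>R (of_real (y powr (1 - 1)) * exp (- w * of_real (y powr 1)))
      = indicator {0<..} y *\<^sub>R exp (- w * of_real y)" for y
    by (auto simp: indicator_def)
  moreover note has_bochner_integral_Gamma_powr_complex[of 1 1 w]
  ultimately show ?thesis
    using assms by (simp only: zero_less_one div_by_1 Gamma_1 of_real_1 mult_1 simp_thms True_implies_equals)
qed

text \<open>The kernel of Levy's inversion formula. At t = 0 division by zero gives 0 instead of the
  limit b - a, at a single point that no Lebesgue integral sees.\<close>

definition levy_kernel :: "real \<Rightarrow> real \<Rightarrow> real \<Rightarrow> complex" where
  "levy_kernel a b t = (iexp (- (t * a)) - iexp (- (t * b))) / (\<i> * t)"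

lemma levy_kernel_measurable [measurable]: "levy_kernel a b \<in> borel_measurable borel"
  unfolding levy_kernel_def by measurable

lemma norm_levy_kernel_le: "a \<le> b \<Longrightarrow> norm (levy_kernel a b t) \<le> b - a"
  using Levy_Inversion_aux2[of "- b" "- a" t] by (cases "t = 0") (simp_all add: levy_kernel_def)

context real_distribution
begin

text \<open>\<open>Levy_Inversion\<close> gives a limit of truncated integrals. The bound b - a on
  the kernel and integrability of the characteristic function turn it into one Lebesgue integral by
  dominated convergence.\<close>

lemma measure_Ioc_eq_integral_char:
  assumes int: "integrable lborel (char M)"
    and "a \<le> b" "measure M {a} = 0" "measure M {b} = 0"
  shows "of_real (measure M {a<..b}) = 1 / (2 * pi) * (CLBINT t. levy_kernel a b t * char M t)"
proof -
  let ?f = "\<lambda>t. levy_kernel a b t * char M t"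
  have "(\<lambda>T::nat. CLBINT t. indicator {- real T<..<real T} t *\<^sub>R ?f t) \<longlonglongrightarrow> (CLBINT t. ?f t)"
  proof (rule integral_dominated_convergence)
    show "integrable lborel (\<lambda>t. (b - a) * norm (char M t))"
      using int by simp
    show "AE t in lborel. (\<lambda>T::nat. indicator {- real T<..<real T} t *\<^sub>R ?f t) \<longlonglongrightarrow> ?f t"
    proof (rule AE_I2)
      fix t :: real
      have "eventually (\<lambda>T::nat. indicator {- real T<..<real T} t *\<^sub>R ?f t = ?f t) sequentially"
        using eventually_gt_at_top[of "nat \<lceil>\<bar>t\<bar>\<rceil>"]
        by eventually_elim (auto simp: indicator_def, linarith+)
      then show "(\<lambda>T::nat. indicator {- real T<..<real T} t *\<^sub>R ?f t) \<longlonglongrightarrow> ?f t"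
        by (rule tendsto_eventually)
    qed
    show "AE t in lborel. norm (indicator {- real T<..<real T} t *\<^sub>R ?f t) \<le> (b - a) * norm (char M t)"
      for T :: nat
      using norm_levy_kernel_le[OF \<open>a \<le> b\<close>] \<open>a \<le> b\<close>
      by (auto simp: norm_mult indicator_def intro!: mult_right_mono)
  qed (use int in measurable)
  then have "(\<lambda>T::nat. 1 / (2 * pi) * (CLBINT t. indicator {- real T<..<real T} t *\<^sub>R ?f t))
      \<longlonglongrightarrow> 1 / (2 * pi) * (CLBINT t. ?f t)"
    by (intro tendsto_intros) auto
  moreover have "(CLBINT t=- real T..real T. (iexp (- (t * a)) - iexp (- (t * b))) / (\<i> * t) * char M t)
      = (CLBINT t. indicator {- real T<..<real T} t *\<^sub>R ?f t)" for T :: nat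
    by (simp add: interval_lebesgue_integral_def set_lebesgue_integral_def levy_kernel_def)
  ultimately show ?thesis
    using Levy_Inversion[OF assms(2-4)] by (intro LIMSEQ_unique) simp_all
qed

text \<open>Frees the inversion formula from its condition on the endpoints, in particular at the
  threshold 0. Inversion bounds the mass of a short interval around \<open>x\<close> by a multiple
  of its length, too little for an atom.\<close>

lemma measure_singleton_eq_0:
  assumes int: "integrable lborel (char M)"
  shows "measure M {x} = 0"
proof (rule ccontr)
  assume "measure M {x} \<noteq> 0"
  then have pos: "0 < measure M {x}" by (simp add: zero_less_measure_iff)
  define C where "C = (LBINT t. norm (char M t))"
  have "0 \<le> C" by (simp add: C_def)
  \<comment> \<open>The + 1 keeps the denominator positive and makes the final comparison of e * C
    with e * (C + 1) strict.\<close>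
  define e where "e = measure M {x} / (C + 1)"
  have e: "0 < e" using pos \<open>0 \<le> C\<close> by (simp add: e_def)
  \<comment> \<open>There are only countably many atoms, so every open interval offers an endpoint
    that is none.\<close>
  obtain a where a: "x - e < a" "a < x" "measure M {a} = 0"
    using open_minus_countable[OF countable_support, of "{x - e<..<x}"] e by auto
  obtain b where b: "x < b" "b < x + e" "measure M {b} = 0"
    using open_minus_countable[OF countable_support, of "{x<..<x + e}"] e by auto
  have "measure M {x} \<le> measure M {a<..b}"
    using a b by (intro finite_measure_mono) auto
  also have "\<dots> = norm (1 / (2 * pi) * (CLBINT t. levy_kernel a b t * char M t))"
    using a b by (subst measure_Ioc_eq_integral_char[OF int, of a b, symmetric]) auto
  also have "\<dots> = 1 / (2 * pi) * norm (CLBINT t. levy_kernel a b t * char M t)"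
  proof -
    have "norm (1 / (2 * pi) * z) = 1 / (2 * pi) * norm z" for z :: complex
      by (simp add: norm_mult norm_divide)
    then show ?thesis .
  qed
  also have "\<dots> \<le> 1 / (2 * pi) * (LBINT t. (b - a) * norm (char M t))"
  proof (rule mult_left_mono)
    have "norm (CLBINT t. levy_kernel a b t * char M t) \<le> (LBINT t. norm (levy_kernel a b t * char M t))"
      by (rule integral_norm_bound)
    also have "\<dots> \<le> (LBINT t. (b - a) * norm (char M t))"
    proof (rule integral_mono)
      show bnd: "norm (levy_kernel a b t * char M t) \<le> (b - a) * norm (char M t)" for t
        using norm_levy_kernel_le[of a b t] a b by (auto simp: norm_mult intro!: mult_right_mono)
      show "integrable lborel (\<lambda>t. (b - a) * norm (char M t))"
        using int by simp
      then show "integrable lborel (\<lambda>t. norm (levy_kernel a b t * char M t))"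
        by (rule Bochner_Integration.integrable_bound) (auto intro!: order_trans[OF bnd])
    qed
    finally show "norm (CLBINT t. levy_kernel a b t * char M t) \<le> (LBINT t. (b - a) * norm (char M t))" .
  qed simp
  also have "\<dots> = (b - a) * C / (2 * pi)" by (simp add: C_def)
  also have "\<dots> \<le> (2 * e) * C / (2 * pi)"
    using a b \<open>0 \<le> C\<close> by (intro divide_right_mono mult_right_mono) auto
  also have "\<dots> = e * C / pi" by simp
  also have "\<dots> \<le> e * C / 1"
    using e \<open>0 \<le> C\<close> pi_gt3 by (intro divide_left_mono) auto
  also have "\<dots> < e * (C + 1)" using e by simp
  also have "\<dots> = measure M {x}" using \<open>0 \<le> C\<close> by (simp add: e_def)
  finally show False by simp
qed

text \<open>For y > 0, exp (- \<theta> y) is the integral of the density \<theta> exp (- \<theta> t)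
  over t \<ge> y. So the transform is the average of the masses of (0, t] under that density, and
  inversion applies to each mass.\<close>

lemma laplace_transform_eq_integral_char:
  assumes int: "integrable lborel (char M)" and "0 < \<theta>"
  shows "of_real (\<integral>y. exp (- \<theta> * y) * indicator {0<..} y \<partial>M)
    = 1 / (2 * pi) * (CLBINT k. char M k / (of_real \<theta> + \<i> * of_real k))"
proof -
  interpret P: pair_sigma_finite lborel M ..
  note char_measurable [measurable]
  define g where "g t = indicator {0<..} t * (\<theta> * exp (- (t * \<theta>)))" for t :: real
  have g0: "0 \<le> g t" for t using \<open>0 < \<theta>\<close> by (simp add: g_def)
  have [measurable]: "g \<in> borel_measurable borel" unfolding g_def by measurable
  have g: "integrable lborel g"
  proof -
    have "integrable lborel (\<lambda>t. \<theta> * (indicator {0<..} t *\<^sub>R exp (- (t * \<theta>))))"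
      using integrable_I0i_exp_mscale[OF \<open>0 < \<theta>\<close>]
      by (intro integrable_mult_right) (simp add: set_integrable_def)
    then show ?thesis by (simp add: g_def[abs_def] mult.left_commute)
  qed
  \<comment> \<open>The kernel for (0, t] is bounded only by t, so the second use of Fubini needs
    the first moment of \<open>g\<close>.\<close>
  have gt: "integrable lborel (\<lambda>t. t * g t)"
  proof -
    have "integrable lborel (\<lambda>t. \<theta> * (indicator {0<..} t * (t powr (1 * 2 - 1) * exp (- \<theta> * t powr 1))))"
      using has_bochner_integral_Gamma_powr[of 2 \<theta> 1] \<open>0 < \<theta>\<close>
      by (intro integrable_mult_right integrable.intros) simp
    also have "(\<lambda>t. \<theta> * (indicator {0<..} t * (t powr (1 * 2 - 1) * exp (- \<theta> * t powr 1)))) = (\<lambda>t. t * g t)"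
      by (auto simp: g_def indicator_def mult_ac)
    finally show ?thesis .
  qed
  have tail: "(LBINT t. g t * indicator {0<..t} y) = exp (- \<theta> * y) * indicator {0<..} y" for y
  proof (cases "0 < y")
    case True
    have "has_bochner_integral lborel (\<lambda>t. ((\<theta> * exp (- (t * \<theta>)))) * indicator {y..} t) (0 - (- exp (- (y * \<theta>))))"
    proof (rule has_bochner_integral_nn_integral)
      have "((\<lambda>t. - exp (- (t * \<theta>))) \<longlongrightarrow> 0) at_top"
        using \<open>0 < \<theta>\<close> by real_asymp
      then have "(\<integral>\<^sup>+t. ennreal (\<theta> * exp (- (t * \<theta>))) * indicator {y..} t \<partial>lborel) = ennreal (0 - (- exp (- (y * \<theta>))))"
        using \<open>0 < \<theta>\<close>
        by (intro nn_integral_FTC_atLeast) (auto intro!: derivative_eq_intros)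
      then show "(\<integral>\<^sup>+t. ennreal (\<theta> * exp (- (t * \<theta>)) * indicator {y..} t) \<partial>lborel) = ennreal (0 - (- exp (- (y * \<theta>))))"
        by (subst nn_integral_cong) (auto simp: indicator_def)
    qed (use \<open>0 < \<theta>\<close> in auto)
    then have "(LBINT t. (\<theta> * exp (- (t * \<theta>))) * indicator {y..} t) = exp (- \<theta> * y)"
      by (simp add: has_bochner_integral_iff mult.commute)
    moreover have "g t * indicator {0<..t} y = (\<theta> * exp (- (t * \<theta>))) * indicator {y..} t" for t
      using True by (auto simp: g_def indicator_def)
    ultimately show ?thesis using True by simp
  qed (simp add: g_def)
  have "integrable (lborel \<Otimes>\<^sub>M M) (\<lambda>(t, y). g t * indicator {0<..t} y)"
  proof (rule P.Fubini_integrable)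
    show "(\<lambda>(t, y). g t * indicator {0<..t} y) \<in> borel_measurable (lborel \<Otimes>\<^sub>M M)"
      unfolding indicator_def greaterThanAtMost_iff by measurable
    have "(\<integral>y. norm (g t * indicator {0<..t} y) \<partial>M) = g t * measure M {0<..t}" for t
      using g0 by (simp add: abs_mult)
    moreover have "integrable lborel (\<lambda>t. g t * measure M {0<..t})"
    proof (rule Bochner_Integration.integrable_bound[OF g])
      have "(\<lambda>(t, y). indicator {0<..t} y :: real) \<in> borel_measurable (lborel \<Otimes>\<^sub>M M)"
        unfolding indicator_def greaterThanAtMost_iff by measurable
      from borel_measurable_lebesgue_integral[OF this] show "(\<lambda>t. g t * measure M {0<..t}) \<in> borel_measurable lborel" by simp
      show "AE t in lborel. norm (g t * measure M {0<..t}) \<le> norm (g t)"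
        using g0 by (auto simp: abs_mult intro!: mult_left_le)
    qed
    ultimately show "integrable lborel (\<lambda>t. \<integral>y. norm (case (t, y) of (t, y) \<Rightarrow> g t * indicator {0<..t} y) \<partial>M)"
      by simp
  qed (auto intro!: integrable_mult_right simp: emeasure_eq_measure)
  from P.Fubini_integral[OF this]
  have "(\<integral>y. exp (- \<theta> * y) * indicator {0<..} y \<partial>M) = (LBINT t. g t * measure M {0<..t})"
    by (simp add: tail)
  then have "complex_of_real (\<integral>y. exp (- \<theta> * y) * indicator {0<..} y \<partial>M)
      = (CLBINT t. of_real (g t) * of_real (measure M {0<..t}))"
    by (simp flip: integral_complex_of_real)
  also have "\<dots> = (CLBINT t. of_real (g t) * (1 / (2 * pi) * (CLBINT k. levy_kernel 0 t k * char M k)))"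
  proof (rule Bochner_Integration.integral_cong)
    fix t
    show "complex_of_real (g t) * of_real (measure M {0<..t})
        = of_real (g t) * (1 / (2 * pi) * (CLBINT k. levy_kernel 0 t k * char M k))"
    proof (cases "0 \<le> t")
      case True
      then show ?thesis
        using measure_Ioc_eq_integral_char[OF int, of 0 t] measure_singleton_eq_0[OF int] by simp
    qed (simp add: g_def)
  qed simp
  also have "\<dots> = 1 / (2 * pi) * (CLBINT t. CLBINT k. of_real (g t) * (levy_kernel 0 t k * char M k))"
    by (simp add: mult.left_commute)
  also have "(CLBINT t. CLBINT k. of_real (g t) * (levy_kernel 0 t k * char M k))
      = (CLBINT k. CLBINT t. of_real (g t) * (levy_kernel 0 t k * char M k))"
  proof (rule lborel_pair.Fubini_integral[symmetric])
    have meas [measurable]: "(\<lambda>(t, k). of_real (g t) * (levy_kernel 0 t k * char M k))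
        \<in> borel_measurable (lborel \<Otimes>\<^sub>M lborel)"
      unfolding levy_kernel_def by measurable
    have bnd: "norm (of_real (g t) * (levy_kernel 0 t k * char M k)) \<le> (t * g t) * norm (char M k)" for t k
    proof (cases "0 \<le> t")
      case True
      then have "g t * (norm (levy_kernel 0 t k) * norm (char M k)) \<le> g t * (t * norm (char M k))"
        using norm_levy_kernel_le[of 0 t k] g0[of t] by (intro mult_left_mono mult_right_mono) auto
      then show ?thesis using g0[of t] by (simp add: norm_mult mult_ac)
    qed (simp add: g_def)
    have i1: "integrable lborel (\<lambda>k. of_real (g t) * (levy_kernel 0 t k * char M k))" for t
    proof (rule Bochner_Integration.integrable_bound)
      show "integrable lborel (\<lambda>k. (t * g t) * norm (char M k))" using int by simp
      show "AE k in lborel. norm (of_real (g t) * (levy_kernel 0 t k * char M k)) \<le> norm ((t * g t) * norm (char M k))"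
        unfolding real_norm_def by (intro AE_I2 order_trans[OF bnd abs_ge_self])
    qed (use int in measurable)
    show "integrable (lborel \<Otimes>\<^sub>M lborel) (\<lambda>(t, k). of_real (g t) * (levy_kernel 0 t k * char M k))"
    proof (rule lborel_pair.Fubini_integrable)
      show "integrable lborel (\<lambda>t. LBINT k. norm (case (t, k) of (t, k) \<Rightarrow> of_real (g t) * (levy_kernel 0 t k * char M k)))"
      proof (rule Bochner_Integration.integrable_bound)
        show "integrable lborel (\<lambda>t. (t * g t) * (LBINT k. norm (char M k)))"
          using gt by simp
        show "AE t in lborel. norm (LBINT k. norm (case (t, k) of (t, k) \<Rightarrow> of_real (g t) * (levy_kernel 0 t k * char M k)))
            \<le> norm ((t * g t) * (LBINT k. norm (char M k)))"
        proof (rule AE_I2)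
          fix t
          have "norm (LBINT k. norm (of_real (g t) * (levy_kernel 0 t k * char M k)))
            = (LBINT k. norm (of_real (g t) * (levy_kernel 0 t k * char M k)))"
            by simp
          also have "\<dots> \<le> (LBINT k. (t * g t) * norm (char M k))"
            using i1[of t] int bnd by (intro integral_mono) auto
          also have "\<dots> \<le> norm ((t * g t) * (LBINT k. norm (char M k)))"
            by simp
          finally show "norm (LBINT k. norm (case (t, k) of (t, k) \<Rightarrow> of_real (g t) * (levy_kernel 0 t k * char M k)))
            \<le> norm ((t * g t) * (LBINT k. norm (char M k)))" by simp
        qed
      qed measurable
    qed (use i1 in simp_all)
  qed
  also have "(CLBINT k. CLBINT t. of_real (g t) * (levy_kernel 0 t k * char M k))
      = (CLBINT k. char M k / (of_real \<theta> + \<i> * of_real k))"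
  proof (rule integral_cong_AE)
    show "AE k in lborel. (CLBINT t. of_real (g t) * (levy_kernel 0 t k * char M k)) = char M k / (of_real \<theta> + \<i> * of_real k)"
      using AE_lborel_singleton[of 0]
    proof eventually_elim
      case (elim k)
      have nz: "of_real \<theta> + \<i> * of_real k \<noteq> 0" using \<open>0 < \<theta>\<close> by (auto simp: complex_eq_iff)
      let ?E = "\<lambda>w t. indicator {0<..} t *\<^sub>R exp (- w * complex_of_real t)"
      \<comment> \<open>The kernel for (0, t] is (1 - exp (- \<i> k t)) / (\<i> k), so averaging it
        over \<open>g\<close> leaves the difference of two exponential integrals. Division by k is
        why k = 0 is left out.\<close>
      have "has_bochner_integral lborel (\<lambda>t. char M k * \<theta> / (\<i> * k) * (?E (of_real \<theta>) t - ?E (of_real \<theta> + \<i> * of_real k) t))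
          (char M k * \<theta> / (\<i> * k) * (1 / of_real \<theta> - 1 / (of_real \<theta> + \<i> * of_real k)))"
        by (intro has_bochner_integral_mult_right has_bochner_integral_diff has_bochner_integral_exp_complex)
           (use \<open>0 < \<theta>\<close> in auto)
      moreover have "char M k * \<theta> / (\<i> * k) * (?E (of_real \<theta>) t - ?E (of_real \<theta> + \<i> * of_real k) t)
          = of_real (g t) * (levy_kernel 0 t k * char M k)" for t
      proof -
        have 1: "complex_of_real (exp (- (t * \<theta>))) = exp (- of_real \<theta> * of_real t)"
          by (simp add: mult.commute flip: exp_of_real)
        have 2: "exp (- (of_real \<theta> + \<i> * of_real k) * of_real t)
            = exp (- of_real \<theta> * of_real t) * iexp (- (k * t))"
          by (simp add: algebra_simps flip: exp_add)
        show ?thesis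
        proof (cases "0 < t")
          case True
          then have d: "?E (of_real \<theta>) t - ?E (of_real \<theta> + \<i> * of_real k) t
              = exp (- of_real \<theta> * of_real t) * (1 - iexp (- (k * t)))"
            unfolding 2 by (simp add: right_diff_distrib)
          have e: "complex_of_real (g t) = of_real \<theta> * exp (- complex_of_real \<theta> * complex_of_real t)"
            using True unfolding g_def of_real_mult 1 by simp
          show ?thesis unfolding d e levy_kernel_def by simp
        qed (simp add: g_def)
      qed
      moreover have "char M k * \<theta> / (\<i> * k) * (1 / of_real \<theta> - 1 / (of_real \<theta> + \<i> * of_real k))
          = char M k / (of_real \<theta> + \<i> * of_real k)"
      proof -
        have "1 / of_real \<theta> - 1 / (of_real \<theta> + \<i> * of_real k)
            = (\<i> * of_real k) / (of_real \<theta> * (of_real \<theta> + \<i> * of_real k))"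
          using nz \<open>0 < \<theta>\<close> by (subst diff_frac_eq) simp_all
        then show ?thesis using elim \<open>0 < \<theta>\<close> by simp
      qed
      ultimately show ?case by (simp only: has_bochner_integral_integral_eq)
    qed
  qed (simp_all add: levy_kernel_def)
  finally show ?thesis .
qed

end

section \<open>Vertical line integrals\<close>

text \<open>With a = - \<mu> \<tau> this is exp (- \<mu> \<tau> s^\<alpha>), on the imaginary axis
  the characteristic function of the driving variable. The principal branch puts the branch point 0
  on the boundary of the right half-plane.\<close>

definition stable_laplace :: "real \<Rightarrow> real \<Rightarrow> complex \<Rightarrow> complex" where
  "stable_laplace a \<alpha> s = exp (of_real a * s powr of_real \<alpha>)"

abbreviation vline :: "real \<Rightarrow> real \<Rightarrow> complex" where
  "vline q y \<equiv> complex_of_real q + \<i> * complex_of_real y"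

lemma Re_powr_of_real:
  assumes "s \<noteq> 0"
  shows "Re (s powr of_real \<alpha>) = norm s powr \<alpha> * cos (\<alpha> * Im (Ln s))"
  using assms by (simp add: powr_def Re_exp)

lemma norm_stable_laplace:
  "norm (stable_laplace a \<alpha> s) = exp (a * Re (s powr of_real \<alpha>))"
  by (simp add: stable_laplace_def)

text \<open>The rate \<open>A\<close> is arbitrary because |Im s|^\<alpha> outgrows |Im s| when
  \<alpha> > 1. This freedom later absorbs powers of s and exponential factors.\<close>

lemma stable_laplace_decay:
  assumes "0 < a" "1 < \<alpha>" "\<alpha> \<le> 2" "0 \<le> q" "0 \<le> A"
  obtains C where "0 < C"
    "\<And>s. 0 \<le> Re s \<Longrightarrow> Re s \<le> q \<Longrightarrow> norm (stable_laplace a \<alpha> s) \<le> C * exp (- A * \<bar>Im s\<bar>)"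
proof -
  \<comment> \<open>Any angle strictly between \<open>pi / (2 * \<alpha>)\<close> and \<open>pi / 2\<close> works: beyond it \<open>cos (\<alpha> * arg s)\<close> is
    negative and bounded away from 0, and before it \<open>s\<close> stays in a bounded part of the strip.\<close>
  define \<psi> where "\<psi> = (pi / (2 * \<alpha>) + pi / 2) / 2"
  have \<psi>: "pi / 2 < \<alpha> * \<psi>" "0 < \<psi>" "\<psi> < pi / 2"
    using assms by (auto simp: \<psi>_def field_simps intro!: add_pos_pos)
  have "\<alpha> * \<psi> \<le> 2 * \<psi>" using assms \<psi> by (intro mult_right_mono) auto
  with \<psi> have "\<alpha> * \<psi> < pi" by simp
  define \<kappa> where "\<kappa> = - cos (\<alpha> * \<psi>)"
  have \<kappa>: "0 < \<kappa>"
    using cos_monotone_0_pi[of "pi / 2" "\<alpha> * \<psi>"] \<psi> \<open>\<alpha> * \<psi> < pi\<close> by (simp add: \<kappa>_def)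
  \<comment> \<open>As long as |arg s| < \<psi>, the bound |s| cos (arg s) = Re s \<le> q forces |s|
    \<le> R.\<close>
  define R where "R = q / cos \<psi>"
  have cos\<psi>: "0 < cos \<psi>" using \<psi> by (intro cos_gt_zero) auto
  \<comment> \<open>Beyond Y the term a \<kappa> y^\<alpha> is at least A y; below it the constant A
    Y covers A y.\<close>
  define Y where "Y = (A / (a * \<kappa>)) powr (1 / (\<alpha> - 1))"
  have "0 \<le> Y" by (simp add: Y_def)
  have key: "- (a * \<kappa> * y powr \<alpha>) \<le> A * Y - A * y" if "0 \<le> y" for y
  proof (cases "y \<le> Y")
    case True
    then have "A * y \<le> A * Y" using assms by (intro mult_left_mono)
    moreover have "0 \<le> a * \<kappa> * y powr \<alpha>" using assms \<kappa> by simp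
    ultimately show ?thesis by linarith
  next
    case False
    then have "0 < y" using \<open>0 \<le> Y\<close> by simp
    have "A / (a * \<kappa>) = Y powr (\<alpha> - 1)"
      using assms \<kappa> by (simp add: Y_def powr_powr)
    also have "\<dots> \<le> y powr (\<alpha> - 1)"
      using False \<open>0 \<le> Y\<close> assms by (intro powr_mono2) auto
    finally have "A \<le> a * \<kappa> * y powr (\<alpha> - 1)" using assms \<kappa> by (simp add: field_simps)
    then have "A * y \<le> a * \<kappa> * y powr (\<alpha> - 1) * y"
      using \<open>0 < y\<close> by (intro mult_right_mono) auto
    also have "\<dots> = a * \<kappa> * y powr \<alpha>"
      using \<open>0 < y\<close> by (simp add: powr_diff)
    finally show ?thesis using assms \<open>0 \<le> Y\<close> by (smt (verit) mult_nonneg_nonneg)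
  qed
  \<comment> \<open>One summand per regime: s = 0, which has no argument; arguments beyond \<psi>;
    arguments before \<psi>.\<close>
  define C where "C = 1 + exp (A * Y) + exp (a * R powr \<alpha> + A * R)"
  show thesis
  proof
    show "0 < C" unfolding C_def by (smt (verit) exp_gt_zero)
    fix s assume s: "0 \<le> Re s" "Re s \<le> q"
    show "norm (stable_laplace a \<alpha> s) \<le> C * exp (- A * \<bar>Im s\<bar>)"
    proof (cases "s = 0")
      case True
      then show ?thesis by (simp add: stable_laplace_def C_def add_nonneg_nonneg)
    next
      case False
      let ?t = "\<bar>Im (Ln s)\<bar>"
      have t: "?t \<le> pi / 2" using Re_Ln_pos_le[OF False] s by simp
      have cos_abs: "cos (\<alpha> * Im (Ln s)) = cos (\<alpha> * ?t)"
        by (cases "0 \<le> Im (Ln s)") simp_all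
      have "a * Re (s powr of_real \<alpha>) + A * \<bar>Im s\<bar> \<le> max (A * Y) (a * R powr \<alpha> + A * R)"
      proof (cases "\<psi> \<le> ?t")
        case True
        have "\<alpha> * ?t \<le> 2 * ?t" using assms by (intro mult_right_mono) auto
        then have "cos (\<alpha> * ?t) \<le> - \<kappa>"
          unfolding \<kappa>_def minus_minus
          using True \<psi> t assms by (intro cos_monotone_0_pi_le) auto
        then have "norm s powr \<alpha> * cos (\<alpha> * ?t) \<le> norm s powr \<alpha> * (- \<kappa>)"
          by (rule mult_left_mono) simp
        also have "\<dots> \<le> \<bar>Im s\<bar> powr \<alpha> * (- \<kappa>)"
          using \<kappa> assms abs_Im_le_cmod[of s] by (simp add: powr_mono2)
        finally have "a * Re (s powr of_real \<alpha>) \<le> a * (\<bar>Im s\<bar> powr \<alpha> * (- \<kappa>))"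
          unfolding Re_powr_of_real[OF False] cos_abs using assms by (intro mult_left_mono) auto
        also have "\<dots> \<le> A * Y - A * \<bar>Im s\<bar>"
          using key[of "\<bar>Im s\<bar>"] by (simp add: mult_ac)
        finally show ?thesis by simp
      next
        case False': False
        have "Re s = norm s * cos (Im (Ln s))"
          using Re_exp[of "Ln s"] False by simp
        also have "cos (Im (Ln s)) = cos ?t" by (cases "0 \<le> Im (Ln s)") simp_all
        finally have "norm s * cos ?t \<le> q" using s by simp
        moreover have "cos \<psi> \<le> cos ?t"
          using False' \<psi> by (intro cos_monotone_0_pi_le) auto
        then have "norm s * cos \<psi> \<le> norm s * cos ?t" by (intro mult_left_mono) auto
        ultimately have R: "norm s \<le> R" using cos\<psi> by (simp add: R_def field_simps)
        have "Re (s powr of_real \<alpha>) \<le> norm s powr \<alpha> * 1"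
          unfolding Re_powr_of_real[OF False] by (intro mult_left_mono) auto
        also have "\<dots> \<le> R powr \<alpha>" using R assms by (simp add: powr_mono2)
        finally have "a * Re (s powr of_real \<alpha>) \<le> a * R powr \<alpha>"
          using assms by (intro mult_left_mono) auto
        moreover have "A * \<bar>Im s\<bar> \<le> A * R"
          using assms R abs_Im_le_cmod[of s] by (intro mult_left_mono) auto
        ultimately show ?thesis by simp
      qed
      then have "exp (a * Re (s powr of_real \<alpha>) + A * \<bar>Im s\<bar>)
          \<le> max (exp (A * Y)) (exp (a * R powr \<alpha> + A * R))"
        by (simp add: le_max_iff_disj)
      also have "\<dots> \<le> C" unfolding C_def by (auto simp: add_nonneg_nonneg)
      finally show ?thesis
        unfolding norm_stable_laplace by (simp add: exp_add exp_minus field_simps)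
    qed
  qed
qed

lemma integrable_exp_minus_abs: "integrable lborel (\<lambda>y::real. exp (- \<bar>y\<bar>))"
proof -
  have "integrable lborel (\<lambda>y::real. indicator {0<..} y * exp (- y))"
    using integrable_I0i_exp_mscale[of 1] by (simp add: set_integrable_def)
  then have "integrable lborel (\<lambda>y::real. indicator {0<..} y * exp (- y) + indicator {0<..} (- y) * exp (- (- y)))"
    using lborel_integrable_real_affine[of "\<lambda>y::real. indicator {0<..} y * exp (- y)" "- 1" 0]
    by (intro Bochner_Integration.integrable_add) auto
  then show ?thesis
    by (rule integrable_cong_AE_imp) (use AE_lborel_singleton[of 0] in \<open>auto simp: indicator_def\<close>)
qed

lemma continuous_on_stable_laplace:
  assumes "0 < \<alpha>"
  shows "continuous_on {s. 0 \<le> Re s} (stable_laplace a \<alpha>)"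
  unfolding stable_laplace_def[abs_def]
  using assms by (intro continuous_intros) auto

lemma holomorphic_on_stable_laplace: "stable_laplace a \<alpha> holomorphic_on {s. 0 < Re s}"
  unfolding stable_laplace_def[abs_def]
  by (intro holomorphic_intros) (auto simp: complex_nonpos_Reals_iff)

lemma tendsto_integral_symmetric_interval:
  fixes g :: "real \<Rightarrow> 'a :: {banach, second_countable_topology}"
  assumes "integrable lborel g"
  shows "(\<lambda>n::nat. \<integral>y. indicator {- real n..real n} y *\<^sub>R g y \<partial>lborel) \<longlonglongrightarrow> (\<integral>y. g y \<partial>lborel)"
proof (rule integral_dominated_convergence)
  show "integrable lborel (\<lambda>y. norm (g y))" using assms by simp
  show "AE y in lborel. (\<lambda>n::nat. indicator {- real n..real n} y *\<^sub>R g y) \<longlonglongrightarrow> g y"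
  proof (rule AE_I2)
    fix y :: real
    have "eventually (\<lambda>n::nat. indicator {- real n..real n} y *\<^sub>R g y = g y) sequentially"
      using eventually_gt_at_top[of "nat \<lceil>\<bar>y\<bar>\<rceil>"]
      by eventually_elim (auto simp: indicator_def, linarith+)
    then show "(\<lambda>n::nat. indicator {- real n..real n} y *\<^sub>R g y) \<longlonglongrightarrow> g y"
      by (rule tendsto_eventually)
  qed
  show "AE y in lborel. norm (indicator {- real n..real n} y *\<^sub>R g y) \<le> norm (g y)" for n :: nat
    by (auto simp: indicator_def)
qed (use assms in measurable)

lemma integral_derivative_eq_0:
  fixes F f :: "real \<Rightarrow> complex"
  assumes F: "\<And>y. (F has_vector_derivative f y) (at y)"
    and f: "continuous_on UNIV f" "integrable lborel f"
    and bnd: "\<And>y. norm (F y) \<le> C * exp (- \<bar>y\<bar>)"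
  shows "(CLBINT y. f y) = 0"
proof (rule LIMSEQ_unique)
  have "(\<integral>y. indicator {- real n..real n} y *\<^sub>R f y \<partial>lborel) = F (real n) - F (- real n)" for n :: nat
    by (rule integral_FTC_atLeastAtMost)
       (auto intro!: has_vector_derivative_at_within F continuous_on_subset[OF f(1)])
  then show "(\<lambda>n::nat. F (real n) - F (- real n)) \<longlonglongrightarrow> (CLBINT y. f y)"
    using tendsto_integral_symmetric_interval[OF f(2)] by simp
  have e: "(\<lambda>n::nat. C * exp (- \<bar>real n\<bar>)) \<longlonglongrightarrow> 0" by real_asymp
  have "(\<lambda>n::nat. F (real n)) \<longlonglongrightarrow> 0" "(\<lambda>n::nat. F (- real n)) \<longlonglongrightarrow> 0"
    by (rule Lim_null_comparison[OF _ e], use bnd[of "real _"] bnd[of "- real _"] in simp)+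
  from tendsto_diff[OF this] show "(\<lambda>n::nat. F (real n) - F (- real n)) \<longlonglongrightarrow> 0" by simp
qed

lemma vertical_line_integrable:
  fixes f :: "complex \<Rightarrow> complex"
  assumes "continuous_on {s. 0 \<le> Re s} f" "0 \<le> q"
    and bnd: "\<And>y. norm (f (vline q y)) \<le> C * exp (- \<bar>y\<bar>)"
  shows "integrable lborel (\<lambda>y. f (vline q y))"
proof (rule Bochner_Integration.integrable_bound)
  show "integrable lborel (\<lambda>y. C * exp (- \<bar>y\<bar>))" by (simp add: integrable_exp_minus_abs)
  have "continuous_on UNIV (\<lambda>y. f (vline q y))"
    using assms by (intro continuous_on_compose2[OF assms(1)] continuous_intros) auto
  then show "(\<lambda>y. f (vline q y)) \<in> borel_measurable lborel"
    by (simp add: borel_measurable_continuous_onI)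
  show "AE y in lborel. norm (f (vline q y)) \<le> norm (C * exp (- \<bar>y\<bar>))"
    by (intro AE_I2 order_trans[OF bnd]) simp
qed

text \<open>Replaces a rectangular contour. The convex closed half-plane carries a primitive whose
  existence asks for holomorphy in the interior only, so a branch point at 0 does no harm. The two
  line integrals differ by the increments of the primitive along two horizontal edges, which tend to
  0.\<close>

lemma vertical_line_shift:
  assumes f: "continuous_on {s. 0 \<le> Re s} f" "f holomorphic_on {s. 0 < Re s}" and "0 \<le> q"
    and bnd: "\<And>s. 0 \<le> Re s \<Longrightarrow> Re s \<le> q \<Longrightarrow> norm (f s) \<le> C * exp (- \<bar>Im s\<bar>)"
  shows "(CLBINT y. f (vline 0 y)) = (CLBINT y. f (vline q y))"
proof -
  let ?S = "{s. 0 \<le> Re s}"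
  have "convex ?S" by (rule convex_halfspace_Re_ge)
  moreover have "interior ?S = {s. 0 < Re s}" 
    using interior_halfspace_ge[of "1 :: complex" 0] by (simp add: inner_complex_def)
  ultimately obtain F where F: "\<And>s. s \<in> ?S \<Longrightarrow> (F has_field_derivative f s) (at s within ?S)"
    using holomorphic_convex_primitive[of ?S "{}" f] f
    by (auto simp: holomorphic_on_open open_halfspace_Re_gt field_differentiable_def)
  have line: "(CLBINT y. indicator {- real n..real n} y *\<^sub>R (\<i> * f (vline x y)))
      = F (vline x (real n)) - F (vline x (- real n))" if "0 \<le> x" for x and n :: nat
  proof (rule integral_FTC_atLeastAtMost)
    show "((\<lambda>y. F (vline x y)) has_vector_derivative \<i> * f (vline x y)) (at y within {- real n..real n})" for y
    proof -
      have v: "((vline x) has_vector_derivative \<i>) (at y within {- real n..real n})"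
        by (auto intro!: derivative_eq_intros)
      have d: "(F has_field_derivative f (vline x y)) (at (vline x y) within vline x ` {- real n..real n})"
        by (rule has_field_derivative_subset[OF F]) (use that in auto)
      from field_vector_diff_chain_within[OF v d] show ?thesis
        by (simp add: o_def mult.commute)
    qed
    show "continuous_on {- real n..real n} (\<lambda>y. \<i> * f (vline x y))"
      using that by (intro continuous_intros continuous_on_compose2[OF f(1)]) auto
  qed simp
  have int: "integrable lborel (\<lambda>y. \<i> * f (vline x y))" if "0 \<le> x" "x \<le> q" for x
    using that bnd[of "vline x _"]
    by (intro integrable_mult_right vertical_line_integrable[OF f(1), of x C]) auto
  \<comment> \<open>Mean value inequality on the horizontal segment at height y, where the
    derivative is at most C exp (- |y|).\<close>
  have edge: "norm (F (vline q y) - F (vline 0 y)) \<le> C * exp (- \<bar>y\<bar>) * norm (vline q y - vline 0 y)" for y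
  proof (rule field_differentiable_bound[of "{s. 0 \<le> Re s} \<inter> {s. Re s \<le> q} \<inter> {s. Im s = y}"])
    show "convex ({s. 0 \<le> Re s} \<inter> {s. Re s \<le> q} \<inter> {s. Im s = y})"
      using convex_hyperplane[of \<i> y]
      by (intro convex_Int convex_halfspace_Re_ge convex_halfspace_Re_le) (simp add: inner_complex_def)
    show "(F has_field_derivative f z) (at z within {s. 0 \<le> Re s} \<inter> {s. Re s \<le> q} \<inter> {s. Im s = y})"
      if "z \<in> {s. 0 \<le> Re s} \<inter> {s. Re s \<le> q} \<inter> {s. Im s = y}" for z
      by (rule has_field_derivative_subset[OF F]) (use that in auto)
  qed (use bnd \<open>0 \<le> q\<close> in auto)
  let ?V = "\<lambda>x n. CLBINT y. indicator {- real n..real n} y *\<^sub>R (\<i> * f (vline x y))"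
  have "(\<lambda>n. ?V q n - ?V 0 n) \<longlonglongrightarrow> (CLBINT y. \<i> * f (vline q y)) - (CLBINT y. \<i> * f (vline 0 y))"
    using \<open>0 \<le> q\<close> by (intro tendsto_diff tendsto_integral_symmetric_interval int) auto
  moreover have "(\<lambda>n. ?V q n - ?V 0 n) \<longlonglongrightarrow> 0"
  proof (rule Lim_null_comparison)
    show "(\<lambda>n::nat. 2 * (C * exp (- real n) * q)) \<longlonglongrightarrow> 0" by real_asymp
    show "eventually (\<lambda>n. norm (?V q n - ?V 0 n) \<le> 2 * (C * exp (- real n) * q)) sequentially"
    proof (rule always_eventually, rule allI)
      fix n :: nat
      have "?V q n - ?V 0 n = (F (vline q (real n)) - F (vline 0 (real n)))
          - (F (vline q (- real n)) - F (vline 0 (- real n)))"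
        unfolding line[OF \<open>0 \<le> q\<close>] line[OF order_refl] by (simp only: algebra_simps)
      also have "norm \<dots> \<le> norm (F (vline q (real n)) - F (vline 0 (real n)))
          + norm (F (vline q (- real n)) - F (vline 0 (- real n)))"
        by (rule norm_triangle_ineq4)
      also have "\<dots> \<le> 2 * (C * exp (- real n) * q)"
        using edge[of "real n"] edge[of "- real n"] \<open>0 \<le> q\<close> by simp
      finally show "norm (?V q n - ?V 0 n) \<le> 2 * (C * exp (- real n) * q)" .
    qed
  qed
  ultimately have "(CLBINT y. \<i> * f (vline q y)) - (CLBINT y. \<i> * f (vline 0 y)) = 0"
    by (rule LIMSEQ_unique)
  then show ?thesis by simp
qed

section \<open>Hankel-type integrals\<close>

lemma norm_powr_le_exp:
  fixes s :: complex
  assumes "0 \<le> Re s" "Re s \<le> q" "0 < c"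
  shows "norm (s powr of_real c) \<le> exp (c * q) * exp (c * \<bar>Im s\<bar>)"
proof (cases "s = 0")
  case False
  have "norm (s powr of_real c) = norm s powr c" by (simp add: norm_powr_real_powr')
  also have "\<dots> = exp (c * ln (norm s))" using False by (simp add: powr_def)
  also have "\<dots> \<le> exp (c * (q + \<bar>Im s\<bar>))"
  proof -
    have "ln (norm s) \<le> norm s" using False by (intro ln_bound) simp
    also have "\<dots> \<le> q + \<bar>Im s\<bar>" using cmod_le[of s] assms by simp
    finally show ?thesis using assms by simp
  qed
  finally show ?thesis by (simp add: distrib_left exp_add)
qed simp

text \<open>Exponential growth is generous for a power, but it is the form that the freely chosen
  decay rate absorbs. For c \<le> 0 the bound rests on |s| \<ge> q > 0.\<close>

lemma norm_powr_line_le: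
  fixes c q y :: real
  assumes "0 < q"
  shows "norm (vline q y powr of_real c) \<le> (q powr c + exp (\<bar>c\<bar> * q)) * exp (\<bar>c\<bar> * \<bar>y\<bar>)"
proof (cases "0 < c")
  case True
  then have "norm (vline q y powr of_real c) \<le> exp (\<bar>c\<bar> * q) * exp (\<bar>c\<bar> * \<bar>y\<bar>)"
    using norm_powr_le_exp[of "vline q y" q c] assms by simp
  also have "\<dots> \<le> (q powr c + exp (\<bar>c\<bar> * q)) * exp (\<bar>c\<bar> * \<bar>y\<bar>)"
    by (intro mult_right_mono) auto
  finally show ?thesis .
next
  case False
  have "norm (vline q y powr of_real c) = norm (vline q y) powr c"
    by (simp add: norm_powr_real_powr')
  also have "\<dots> \<le> q powr c"
    using False assms complex_Re_le_cmod[of "vline q y"] by (intro powr_mono2') auto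
  also have "\<dots> \<le> q powr c * exp (\<bar>c\<bar> * \<bar>y\<bar>)"
    using mult_left_mono[of 1 "exp (\<bar>c\<bar> * \<bar>y\<bar>)" "q powr c"] by simp
  also have "\<dots> \<le> (q powr c + exp (\<bar>c\<bar> * q)) * exp (\<bar>c\<bar> * \<bar>y\<bar>)"
    by (intro mult_right_mono) auto
  finally show ?thesis .
qed

lemma stable_laplace_line_integrable:
  assumes "0 < a" "1 < \<alpha>" "\<alpha> \<le> 2" "0 \<le> q" "0 \<le> B"
    and g: "g \<in> borel_measurable borel" "\<And>y. norm (g y) \<le> K * exp (B * \<bar>y\<bar>)"
  shows "integrable lborel (\<lambda>y. g y * stable_laplace a \<alpha> (vline q y))"
proof -
  \<comment> \<open>Rate B + 1 cancels the growth B of \<open>g\<close> and leaves exp (-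
    |y|).\<close>
  obtain C where C: "0 < C"
    "\<And>s. 0 \<le> Re s \<Longrightarrow> Re s \<le> q \<Longrightarrow> norm (stable_laplace a \<alpha> s) \<le> C * exp (- (B + 1) * \<bar>Im s\<bar>)"
    using stable_laplace_decay[of a \<alpha> q "B + 1"] assms by auto
  have "0 \<le> K" using order_trans[OF norm_ge_zero g(2)[of 0]] by simp
  show ?thesis
  proof (rule Bochner_Integration.integrable_bound)
    show "integrable lborel (\<lambda>y. (K * C) * exp (- \<bar>y\<bar>))" by (simp add: integrable_exp_minus_abs)
    have "continuous_on UNIV (\<lambda>y. stable_laplace a \<alpha> (vline q y))"
      using assms by (intro continuous_on_compose2[OF continuous_on_stable_laplace] continuous_intros) auto
    with g(1) show "(\<lambda>y. g y * stable_laplace a \<alpha> (vline q y)) \<in> borel_measurable lborel"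
      by (simp add: borel_measurable_continuous_onI borel_measurable_times)
    show "AE y in lborel. norm (g y * stable_laplace a \<alpha> (vline q y)) \<le> norm ((K * C) * exp (- \<bar>y\<bar>))"
    proof (rule AE_I2)
      fix y
      have "norm (g y * stable_laplace a \<alpha> (vline q y)) \<le> (K * exp (B * \<bar>y\<bar>)) * (C * exp (- (B + 1) * \<bar>y\<bar>))"
        unfolding norm_mult using C(2)[of "vline q y"] assms g(2)[of y] \<open>0 \<le> K\<close>
        by (intro mult_mono) auto
      also have "\<dots> = (K * C) * exp (- \<bar>y\<bar>)"
        by (simp add: algebra_simps flip: exp_add)
      finally show "norm (g y * stable_laplace a \<alpha> (vline q y)) \<le> norm ((K * C) * exp (- \<bar>y\<bar>))"
        using \<open>0 \<le> K\<close> C by simp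
    qed
  qed
qed

text \<open>With s = \<open>vline q y\<close> and ds = \<i> dy this is 1 / (2 pi \<i>) times the
  integral of s^(\<beta> - 1) exp (a s^\<alpha>) ds.\<close>

definition hankel_integral :: "real \<Rightarrow> real \<Rightarrow> real \<Rightarrow> real \<Rightarrow> complex" where
  "hankel_integral a \<alpha> q \<beta> =
     1 / (2 * pi) * (CLBINT y. vline q y powr of_real (\<beta> - 1) * stable_laplace a \<alpha> (vline q y))"

text \<open>The expected value of that integral: formally, w = a s^\<alpha> turns it into Hankel's
  formula for 1 / Gamma at 1 - \<beta> / \<alpha>, and ds / s = dw / (\<alpha> w) supplies the
  factor 1 / \<alpha>.\<close>

definition stable_coeff :: "real \<Rightarrow> real \<Rightarrow> real \<Rightarrow> real" where
  "stable_coeff a \<alpha> \<beta> = 1 / \<alpha> * rGamma (1 - \<beta> / \<alpha>) * a powr (- \<beta> / \<alpha>)"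

lemma vline_powr_measurable [measurable]: "(\<lambda>y. vline q y powr of_real c) \<in> borel_measurable borel"
  by measurable

lemma hankel_integrand_integrable:
  assumes "0 < a" "1 < \<alpha>" "\<alpha> \<le> 2" "0 < q"
  shows "integrable lborel (\<lambda>y. vline q y powr of_real c * stable_laplace a \<alpha> (vline q y))"
  using assms norm_powr_line_le[OF \<open>0 < q\<close>]
  by (intro stable_laplace_line_integrable[where B = "\<bar>c\<bar>"]) auto

lemma integral_symmetric_cnj:
  fixes g :: "real \<Rightarrow> complex"
  assumes g: "has_bochner_integral lborel (\<lambda>y. indicator {0<..} y *\<^sub>R g y) Z"
    and sym: "\<And>y. 0 < y \<Longrightarrow> g (- y) = cnj (g y)" and "g \<in> borel_measurable borel"
  shows "(CLBINT y. g y) = of_real (2 * Re Z)"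
proof -
  have "has_bochner_integral lborel (\<lambda>y. cnj (indicator {0<..} y *\<^sub>R g y)) (cnj Z)"
    using g by (rule has_bochner_integral_cnj)
  then have "has_bochner_integral lborel (\<lambda>y. cnj (indicator {0<..} (0 + (- 1) * y) *\<^sub>R g (0 + (- 1) * y))) (cnj Z /\<^sub>R \<bar>- 1\<bar>)"
    by (rule lborel_has_bochner_integral_real_affine_iff[THEN iffD1, rotated]) simp
  then have "has_bochner_integral lborel
      (\<lambda>y. indicator {0<..} y *\<^sub>R g y + cnj (indicator {0<..} (- y) *\<^sub>R g (- y))) (Z + cnj Z)"
    using has_bochner_integral_add[OF g] by simp
  then have "(CLBINT y. indicator {0<..} y *\<^sub>R g y + cnj (indicator {0<..} (- y) *\<^sub>R g (- y))) = Z + cnj Z"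
    by (rule has_bochner_integral_integral_eq)
  also have "(CLBINT y. indicator {0<..} y *\<^sub>R g y + cnj (indicator {0<..} (- y) *\<^sub>R g (- y))) = (CLBINT y. g y)"
  proof (rule integral_cong_AE)
    show "AE y in lborel. indicator {0<..} y *\<^sub>R g y + cnj (indicator {0<..} (- y) *\<^sub>R g (- y)) = g y"
      using AE_lborel_singleton[of 0]
    proof eventually_elim
      case (elim y)
      then show ?case using sym[of "- y"] by (auto simp: indicator_def)
    qed
  next
    have [measurable]: "g \<in> borel_measurable lborel" "cnj \<in> borel_measurable borel"
      using assms(3) by (auto intro!: borel_measurable_continuous_onI continuous_intros)
    show "(\<lambda>y. indicator {0<..} y *\<^sub>R g y + cnj (indicator {0<..} (- y) *\<^sub>R g (- y))) \<in> borel_measurable lborel"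
      by measurable
  qed (use assms(3) in simp)
  also have "Z + cnj Z = of_real (2 * Re Z)" by (simp add: complex_add_cnj)
  finally show ?thesis .
qed

text \<open>Since \<beta> - 1 > 0, the integrand is continuous at the branch point and the line can
  move to the imaginary axis. There the two halves are conjugate, and the upper one is a Gamma
  integral with rate \<omega> = - a \<i>^\<alpha>, whose real part is positive because cos (\<alpha>
  pi / 2) < 0. The reflection formula converts Gamma times sine into 1 / Gamma.\<close>

lemma hankel_integral_gt_1:
  assumes "0 < a" "1 < \<alpha>" "\<alpha> \<le> 2" "0 < q" "1 < \<beta>"
  shows "hankel_integral a \<alpha> q \<beta> = of_real (stable_coeff a \<alpha> \<beta>)"
proof -
  define f where "f s = s powr of_real (\<beta> - 1) * stable_laplace a \<alpha> s" for s
  obtain C where C: "0 < C"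
    "\<And>s. 0 \<le> Re s \<Longrightarrow> Re s \<le> q \<Longrightarrow> norm (stable_laplace a \<alpha> s) \<le> C * exp (- \<beta> * \<bar>Im s\<bar>)"
    using stable_laplace_decay[of a \<alpha> q \<beta>] assms by auto
  have cont: "continuous_on {s. 0 \<le> Re s} f"
    unfolding f_def using assms by (intro continuous_intros continuous_on_stable_laplace) auto
  have "(CLBINT y. f (vline 0 y)) = (CLBINT y. f (vline q y))"
  proof (rule vertical_line_shift[where C = "exp ((\<beta> - 1) * q) * C"])
    show "f holomorphic_on {s. 0 < Re s}"
      unfolding f_def
      by (intro holomorphic_intros holomorphic_on_stable_laplace) (auto simp: complex_nonpos_Reals_iff)
    fix s assume s: "0 \<le> Re s" "Re s \<le> q"
    have "norm (f s) \<le> (exp ((\<beta> - 1) * q) * exp ((\<beta> - 1) * \<bar>Im s\<bar>)) * (C * exp (- \<beta> * \<bar>Im s\<bar>))"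
      unfolding f_def norm_mult using s assms norm_powr_le_exp[OF s, of "\<beta> - 1"] C(2)[OF s]
      by (intro mult_mono) auto
    also have "\<dots> = exp ((\<beta> - 1) * q) * C * exp (- \<bar>Im s\<bar>)"
      by (simp add: algebra_simps flip: exp_add)
    finally show "norm (f s) \<le> exp ((\<beta> - 1) * q) * C * exp (- \<bar>Im s\<bar>)" .
  qed (use cont assms in auto)
  moreover define \<omega> where "\<omega> = - of_real a * \<i> powr of_real \<alpha>"
  define Z where "Z = \<i> powr of_real (\<beta> - 1) * (of_real (Gamma (\<beta> / \<alpha>) / \<alpha>) * \<omega> powr (- of_real (\<beta> / \<alpha>)))"
  have i_powr: "\<i> powr of_real c = cis (c * pi / 2)" for c
    by (simp add: powr_def cis_conv_exp mult_ac)
  have "cos (\<alpha> * pi / 2) < 0"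
  proof -
    have "\<alpha> * pi \<le> 2 * pi" using assms by (intro mult_right_mono) auto
    then show ?thesis using cos_monotone_0_pi[of "pi / 2" "\<alpha> * pi / 2"] assms by (simp add: field_simps)
  qed
  then have \<omega>: "0 < Re \<omega>" using assms by (simp add: \<omega>_def i_powr mult_pos_neg)
  have "(CLBINT y. f (vline 0 y)) = of_real (2 * Re Z)"
  proof (rule integral_symmetric_cnj)
    have "has_bochner_integral lborel
        (\<lambda>y. \<i> powr of_real (\<beta> - 1) * (indicator {0<..} y *\<^sub>R (of_real (y powr (\<beta> - 1)) * exp (- \<omega> * of_real (y powr \<alpha>))))) Z"
      unfolding Z_def using assms \<omega>
      by (intro has_bochner_integral_mult_right has_bochner_integral_Gamma_powr_complex) auto
    moreover have "\<i> powr of_real (\<beta> - 1) * (indicator {0<..} y *\<^sub>R (of_real (y powr (\<beta> - 1)) * exp (- \<omega> * of_real (y powr \<alpha>))))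
        = indicator {0<..} y *\<^sub>R f (vline 0 y)" for y
    proof (cases "0 < y")
      case True
      have p: "(\<i> * of_real y) powr of_real c = \<i> powr of_real c * of_real (y powr c)" for c
        using powr_of_real_mult_left[OF True, of \<i> "of_real c"] True
        by (simp add: mult.commute powr_of_real)
      have "f (vline 0 y) = \<i> powr of_real (\<beta> - 1) * of_real (y powr (\<beta> - 1)) *
          exp (of_real a * (\<i> powr of_real \<alpha> * of_real (y powr \<alpha>)))"
        by (simp only: f_def stable_laplace_def of_real_0 add_0 p)
      then show ?thesis using True by (simp add: \<omega>_def mult_ac)
    qed simp
    ultimately show "has_bochner_integral lborel (\<lambda>y. indicator {0<..} y *\<^sub>R f (vline 0 y)) Z"
      by (simp only:)
    show "f (vline 0 (- y)) = cnj (f (vline 0 y))" if "0 < y" for y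
    proof -
      have "cnj (vline 0 y powr of_real c) = vline 0 (- y) powr of_real c" for c
        using that by (subst cnj_powr) auto
      then show ?thesis
        by (simp only: f_def stable_laplace_def exp_cnj complex_cnj_mult complex_cnj_complex_of_real)
    qed
    have "continuous_on UNIV (\<lambda>y. f (vline 0 y))"
      by (intro continuous_on_compose2[OF cont] continuous_intros) auto
    then show "(\<lambda>y. f (vline 0 y)) \<in> borel_measurable borel"
      by (rule borel_measurable_continuous_onI)
  qed
  moreover have "Re Z = Gamma (\<beta> / \<alpha>) / \<alpha> * a powr (- \<beta> / \<alpha>) * sin (pi * (\<beta> / \<alpha>))"
  proof -
    \<comment> \<open>The angle \<alpha> pi / 2 - pi lies in (- pi, pi], so the principal logarithm
      returns it unchanged.\<close>
    have "\<omega> = of_real a * cis (\<alpha> * pi / 2 - pi)"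
      by (simp add: \<omega>_def i_powr cis_divide[symmetric] complex_eq_iff)
    moreover have "cis (\<alpha> * pi / 2 - pi) powr (- of_real (\<beta> / \<alpha>)) = cis (- (\<beta> / \<alpha>) * (\<alpha> * pi / 2 - pi))"
    proof -
      have "Ln (cis (\<alpha> * pi / 2 - pi)) = \<i> * of_real (\<alpha> * pi / 2 - pi)"
        unfolding cis_conv_exp
      proof (rule Ln_exp)
        have "\<alpha> * pi \<le> 2 * pi" "0 < \<alpha> * pi" using assms by (auto intro!: mult_right_mono)
        then show "- pi < Im (\<i> * of_real (\<alpha> * pi / 2 - pi))" "Im (\<i> * of_real (\<alpha> * pi / 2 - pi)) \<le> pi"
          by auto
      qed
      then show ?thesis by (simp add: powr_def cis_conv_exp mult_ac)
    qed
    ultimately have "\<omega> powr (- of_real (\<beta> / \<alpha>)) = of_real (a powr (- \<beta> / \<alpha>)) * cis (- (\<beta> / \<alpha>) * (\<alpha> * pi / 2 - pi))"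
      using assms by (simp add: powr_of_real_mult_left powr_of_real[symmetric])
    then have "Z = of_real (Gamma (\<beta> / \<alpha>) / \<alpha> * a powr (- \<beta> / \<alpha>)) *
        (cis ((\<beta> - 1) * pi / 2) * cis (- (\<beta> / \<alpha>) * (\<alpha> * pi / 2 - pi)))"
      unfolding Z_def i_powr by simp
    \<comment> \<open>The multiples \<beta> pi / 2 cancel; the remaining - pi / 2 turns the cosine
      in \<open>Re Z\<close> into a sine.\<close>
    also have "cis ((\<beta> - 1) * pi / 2) * cis (- (\<beta> / \<alpha>) * (\<alpha> * pi / 2 - pi)) = cis (pi * (\<beta> / \<alpha>) - pi / 2)"
      unfolding cis_mult using assms by (intro arg_cong[where f = cis]) (simp add: field_simps)
    finally show ?thesis by (simp add: cos_diff)
  qed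
  moreover
  have "Gamma (\<beta> / \<alpha>) * sin (pi * (\<beta> / \<alpha>)) = pi * rGamma (1 - \<beta> / \<alpha>)"
  proof -
    have "complex_of_real (rGamma x * rGamma (1 - x)) = of_real (sin (pi * x) / pi)" for x
      using rGamma_reflection_complex[of "of_real x"]
      by (simp add: rGamma_complex_of_real[symmetric] sin_of_real[symmetric])
    then have "rGamma (\<beta> / \<alpha>) * rGamma (1 - \<beta> / \<alpha>) = sin (pi * (\<beta> / \<alpha>)) / pi"
      unfolding of_real_eq_iff .
    moreover have "0 < Gamma (\<beta> / \<alpha>)" using assms by (intro Gamma_real_pos) auto
    then have "Gamma (\<beta> / \<alpha>) * rGamma (\<beta> / \<alpha>) = 1" by (simp add: rGamma_inverse_Gamma)
    then have "pi * rGamma (1 - \<beta> / \<alpha>)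
        = pi * Gamma (\<beta> / \<alpha>) * (rGamma (\<beta> / \<alpha>) * rGamma (1 - \<beta> / \<alpha>))"
      by simp
    ultimately show ?thesis by simp
  qed
  then have "Gamma (\<beta> / \<alpha>) / \<alpha> * a powr (- \<beta> / \<alpha>) * sin (pi * (\<beta> / \<alpha>)) = pi * stable_coeff a \<alpha> \<beta>"
    unfolding stable_coeff_def by (simp add: mult_ac)
  ultimately have "(CLBINT y. f (vline q y)) = of_real (2 * (pi * stable_coeff a \<alpha> \<beta>))"
    by (simp only:)
  then show ?thesis
    unfolding hankel_integral_def f_def by simp
qed

text \<open>
  The contour can be pushed onto the imaginary axis only when \<open>\<beta> > 1\<close>. Integration by parts reduces
  smaller \<open>\<beta>\<close> to \<open>\<beta> + \<alpha>\<close>, except \<open>\<beta> = 0\<close>, which is reached by continuity.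
\<close>

lemma hankel_integral_recurrence:
  assumes "0 < a" "1 < \<alpha>" "\<alpha> \<le> 2" "0 < q"
  shows "of_real \<beta> * hankel_integral a \<alpha> q \<beta> = - of_real (a * \<alpha>) * hankel_integral a \<alpha> q (\<beta> + \<alpha>)"
proof -
  let ?G = "\<lambda>c y. vline q y powr of_real c * stable_laplace a \<alpha> (vline q y)"
  define F where "F y = vline q y powr of_real \<beta> * stable_laplace a \<alpha> (vline q y)" for y
  define f where "f y = \<i> * (of_real \<beta> * ?G (\<beta> - 1) y + of_real (a * \<alpha>) * ?G (\<beta> + \<alpha> - 1) y)" for y
  have nz: "vline q y \<notin> \<real>\<^sub>\<le>\<^sub>0" "vline q y \<noteq> 0" for y
    using assms by (auto simp: complex_nonpos_Reals_iff complex_eq_iff)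
  have int: "integrable lborel (?G c)" for c
    by (rule hankel_integrand_integrable) fact+
  have cont: "continuous_on UNIV (?G c)" for c
  proof -
    have "continuous_on UNIV (\<lambda>y. stable_laplace a \<alpha> (vline q y))"
      using assms by (intro continuous_on_compose2[OF continuous_on_stable_laplace] continuous_intros) auto
    moreover have "continuous_on UNIV (\<lambda>y. vline q y powr of_real c)"
      using assms nz by (intro continuous_on_powr_complex continuous_intros) auto
    ultimately show ?thesis by (rule continuous_on_mult[rotated])
  qed
  obtain C where C: "0 < C"
    "\<And>s. 0 \<le> Re s \<Longrightarrow> Re s \<le> q \<Longrightarrow> norm (stable_laplace a \<alpha> s) \<le> C * exp (- (\<bar>\<beta>\<bar> + 1) * \<bar>Im s\<bar>)"
    using stable_laplace_decay[of a \<alpha> q "\<bar>\<beta>\<bar> + 1"] assms by auto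
  have "(CLBINT y. f y) = 0"
  proof (rule integral_derivative_eq_0)
    fix y
    let ?s = "vline q y"
    have "((\<lambda>s. s powr of_real \<beta> * stable_laplace a \<alpha> s) has_field_derivative
        (of_real \<beta> * ?s powr (of_real \<beta> - 1) * stable_laplace a \<alpha> ?s +
         ?s powr of_real \<beta> * (stable_laplace a \<alpha> ?s * (of_real a * (of_real \<alpha> * ?s powr (of_real \<alpha> - 1))))))
        (at ?s within range (vline q))"
      unfolding stable_laplace_def using nz[of y]
      by (auto intro!: derivative_eq_intros)
    moreover have "?s powr of_real \<beta> * ?s powr (of_real \<alpha> - 1) = ?s powr (of_real \<beta> + of_real \<alpha> - 1)"
      unfolding powr_add[symmetric] by (simp add: algebra_simps)
    ultimately have d: "((\<lambda>s. s powr of_real \<beta> * stable_laplace a \<alpha> s) has_field_derivative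
        (of_real \<beta> * ?G (\<beta> - 1) y + of_real (a * \<alpha>) * ?G (\<beta> + \<alpha> - 1) y)) (at ?s within range (vline q))"
      by (simp add: mult_ac)
    have v: "(vline q has_vector_derivative \<i>) (at y within UNIV)"
      by (auto intro!: derivative_eq_intros)
    from field_vector_diff_chain_within[OF v d]
    show "(F has_vector_derivative f y) (at y)"
      by (simp add: o_def F_def[abs_def] f_def mult.commute)
  next
    show "continuous_on UNIV f" unfolding f_def by (intro continuous_intros cont)
    show "integrable lborel f"
      unfolding f_def by (intro integrable_mult_right Bochner_Integration.integrable_add int)
    show "norm (F y) \<le> (q powr \<beta> + exp (\<bar>\<beta>\<bar> * q)) * C * exp (- \<bar>y\<bar>)" for y
    proof -
      have "norm (F y) \<le> ((q powr \<beta> + exp (\<bar>\<beta>\<bar> * q)) * exp (\<bar>\<beta>\<bar> * \<bar>y\<bar>)) * (C * exp (- (\<bar>\<beta>\<bar> + 1) * \<bar>y\<bar>))"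
        unfolding F_def norm_mult using C(2)[of "vline q y"] assms norm_powr_line_le[of q y \<beta>]
        by (intro mult_mono) (auto simp: add_nonneg_nonneg)
      also have "\<dots> = (q powr \<beta> + exp (\<bar>\<beta>\<bar> * q)) * C * exp (- \<bar>y\<bar>)"
        by (simp add: algebra_simps flip: exp_add)
      finally show ?thesis .
    qed
  qed
  moreover have "(CLBINT y. f y) = \<i> * (of_real \<beta> * (CLBINT y. ?G (\<beta> - 1) y) + of_real (a * \<alpha>) * (CLBINT y. ?G (\<beta> + \<alpha> - 1) y))"
    unfolding f_def integral_mult_right_zero
    by (subst Bochner_Integration.integral_add) (auto intro!: integrable_mult_right int simp del: of_real_diff of_real_add of_real_mult)
  ultimately have "of_real \<beta> * (CLBINT y. ?G (\<beta> - 1) y) = - of_real (a * \<alpha>) * (CLBINT y. ?G (\<beta> + \<alpha> - 1) y)"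
    by (simp only: mult_eq_0_iff complex_i_not_zero simp_thms add_eq_0_iff2 mult_minus_left)
  then have "1 / (2 * pi) * (of_real \<beta> * (CLBINT y. ?G (\<beta> - 1) y))
      = 1 / (2 * pi) * (- of_real (a * \<alpha>) * (CLBINT y. ?G (\<beta> + \<alpha> - 1) y))"
    by (simp only:)
  then show ?thesis
    unfolding hankel_integral_def by (simp only: mult_ac)
qed

text \<open>Comes from x * rGamma (x + 1) = rGamma x at x = - \<beta> / \<alpha>, an identity
  without exceptional points.\<close>

lemma stable_coeff_recurrence:
  assumes "0 < a" "0 < \<alpha>"
  shows "\<beta> * stable_coeff a \<alpha> \<beta> = - (a * \<alpha>) * stable_coeff a \<alpha> (\<beta> + \<alpha>)"
proof -
  have 1: "- (\<beta> / \<alpha>) * rGamma (1 - \<beta> / \<alpha>) = rGamma (- (\<beta> / \<alpha>))"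
    using rGamma_plus1[of "- (\<beta> / \<alpha>)"] by (simp add: add.commute)
  have 2: "1 - (\<beta> + \<alpha>) / \<alpha> = - (\<beta> / \<alpha>)"
    using assms by (simp add: field_simps)
  have "- (\<beta> + \<alpha>) / \<alpha> = - \<beta> / \<alpha> - 1" using assms by (simp add: field_simps)
  then have 3: "a * a powr (- (\<beta> + \<alpha>) / \<alpha>) = a powr (- \<beta> / \<alpha>)"
    using assms by (simp add: powr_diff)
  have "\<beta> * stable_coeff a \<alpha> \<beta> = - (- (\<beta> / \<alpha>) * rGamma (1 - \<beta> / \<alpha>)) * a powr (- \<beta> / \<alpha>)"
    by (simp add: stable_coeff_def)
  also have "\<dots> = - rGamma (- (\<beta> / \<alpha>)) * (a * a powr (- (\<beta> + \<alpha>) / \<alpha>))"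
    by (simp only: 1 3)
  also have "\<dots> = - (a * \<alpha>) * stable_coeff a \<alpha> (\<beta> + \<alpha>)"
    unfolding stable_coeff_def 2 using assms by simp
  finally show ?thesis .
qed

lemma hankel_integral_0:
  assumes "0 < a" "1 < \<alpha>" "\<alpha> \<le> 2" "0 < q"
  shows "hankel_integral a \<alpha> q 0 = of_real (stable_coeff a \<alpha> 0)"
proof (rule LIMSEQ_unique)
  let ?b = "\<lambda>n. inverse (real (Suc n))"
  have b: "?b \<longlonglongrightarrow> 0" by (rule LIMSEQ_inverse_real_of_nat)
  have "(\<lambda>n. of_real (stable_coeff a \<alpha> (?b n)) :: complex) \<longlonglongrightarrow> of_real (stable_coeff a \<alpha> 0)"
    unfolding stable_coeff_def using assms
    by (intro tendsto_intros b isCont_tendsto_compose[OF isCont_rGamma[OF continuous_ident]]) auto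
  moreover have "hankel_integral a \<alpha> q (?b n) = of_real (stable_coeff a \<alpha> (?b n))" for n
  proof -
    have "0 < ?b n" by simp
    \<comment> \<open>One step of the recurrence carries the positive exponent 1 / (n + 1) beyond 1,
      and here, unlike at 0, the factor in front can be cancelled.\<close>
    with assms have "1 < ?b n + \<alpha>" by linarith
    then have "of_real (?b n) * hankel_integral a \<alpha> q (?b n)
        = of_real (- (a * \<alpha>) * stable_coeff a \<alpha> (?b n + \<alpha>))"
      unfolding hankel_integral_recurrence[OF assms] using hankel_integral_gt_1[OF assms] by simp
    also have "\<dots> = of_real (?b n) * of_real (stable_coeff a \<alpha> (?b n))"
      using assms by (simp only: stable_coeff_recurrence[symmetric] of_real_mult)
    finally have "of_real (?b n) * hankel_integral a \<alpha> q (?b n)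
        = of_real (?b n) * of_real (stable_coeff a \<alpha> (?b n))" .
    moreover have "complex_of_real (?b n) \<noteq> 0" using \<open>0 < ?b n\<close> by (simp only: of_real_eq_0_iff)
    ultimately show ?thesis by (rule mult_left_cancel[THEN iffD1, rotated])
  qed
  ultimately show "(\<lambda>n. hankel_integral a \<alpha> q (?b n)) \<longlonglongrightarrow> of_real (stable_coeff a \<alpha> 0)" by simp
  let ?G = "\<lambda>\<beta> y. vline q y powr of_real (\<beta> - 1) * stable_laplace a \<alpha> (vline q y)"
  have nz: "vline q y \<noteq> 0" "vline q y \<notin> \<real>\<^sub>\<le>\<^sub>0" for y
    using assms by (auto simp: complex_eq_iff complex_nonpos_Reals_iff)
  have "(\<lambda>n. CLBINT y. ?G (?b n) y) \<longlonglongrightarrow> (CLBINT y. ?G 0 y)"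
  proof (rule integral_dominated_convergence)
    show "?G 0 \<in> borel_measurable lborel" "?G (?b n) \<in> borel_measurable lborel" for n
      by (rule borel_measurable_integrable[OF hankel_integrand_integrable[OF assms]])+
    \<comment> \<open>The exponents 1 / (n + 1) - 1 lie in (- 1, 0], so |s| \<ge> q bounds the
      powers by the larger of 1 and 1 / q.\<close>
    show "integrable lborel (\<lambda>y. (1 + 1 / q) * norm (vline q y powr of_real 0 * stable_laplace a \<alpha> (vline q y)))"
      by (intro integrable_mult_right integrable_norm hankel_integrand_integrable assms)
    show "AE y in lborel. (\<lambda>n. ?G (?b n) y) \<longlonglongrightarrow> ?G 0 y"
      using nz by (intro AE_I2 tendsto_intros b) auto
    show "AE y in lborel. norm (?G (?b n) y) \<le> (1 + 1 / q) * norm (vline q y powr of_real 0 * stable_laplace a \<alpha> (vline q y))" for n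
    proof (rule AE_I2)
      fix y
      have "norm (vline q y powr of_real (?b n - 1)) = norm (vline q y) powr (?b n - 1)"
        by (simp add: norm_powr_real_powr' del: of_real_diff)
      also have "\<dots> \<le> q powr (?b n - 1)"
        using assms complex_Re_le_cmod[of "vline q y"] by (intro powr_mono2') (auto simp: field_simps)
      also have "\<dots> \<le> 1 + 1 / q"
      proof (cases "1 \<le> q")
        case True
        then have "q powr (?b n - 1) \<le> q powr 0" by (intro powr_mono) (auto simp: field_simps)
        also have "\<dots> \<le> 1 + 1 / q" using assms by simp
        finally show ?thesis .
      next
        case False
        then have "q powr (?b n - 1) \<le> q powr (- 1)" using assms by (intro powr_mono') auto
        then show ?thesis using assms by (simp add: powr_minus divide_inverse)
      qed
      finally show "norm (?G (?b n) y) \<le> (1 + 1 / q) * norm (vline q y powr of_real 0 * stable_laplace a \<alpha> (vline q y))"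
        unfolding norm_mult using nz(1)[of y] by (simp add: mult_right_mono)
    qed
  qed
  then show "(\<lambda>n. hankel_integral a \<alpha> q (?b n)) \<longlonglongrightarrow> hankel_integral a \<alpha> q 0"
    unfolding hankel_integral_def by (intro tendsto_intros)
qed

lemma hankel_integral_eq:
  assumes "0 < a" "1 < \<alpha>" "\<alpha> \<le> 2" "0 < q"
  shows "hankel_integral a \<alpha> q \<beta> = of_real (stable_coeff a \<alpha> \<beta>)"
proof -
  \<comment> \<open>\<open>k\<close> bounds the number of steps of length \<alpha> that carry
    \<beta> beyond 1. The chain may pass through 0, where the recurrence does not determine the
    integral.\<close>
  have "hankel_integral a \<alpha> q \<beta> = of_real (stable_coeff a \<alpha> \<beta>)" if "1 < \<beta> + real k * \<alpha>" for k
    using that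
  proof (induction k arbitrary: \<beta>)
    case 0
    then show ?case using assms by (intro hankel_integral_gt_1) auto
  next
    case (Suc k)
    show ?case
    proof (cases "\<beta> = 0")
      case False
      have "of_real \<beta> * hankel_integral a \<alpha> q \<beta> = of_real (\<beta> * stable_coeff a \<alpha> \<beta>)"
        using Suc.IH[of "\<beta> + \<alpha>"] Suc.prems assms
        by (simp add: hankel_integral_recurrence stable_coeff_recurrence algebra_simps)
      then show ?thesis using False by simp
    qed (use hankel_integral_0[OF assms] in simp)
  qed
  moreover obtain k :: nat where "1 - \<beta> < real k" using reals_Archimedean2 by blast
  moreover have "real k \<le> real k * \<alpha>" using mult_left_mono[of 1 \<alpha> "real k"] assms by simp
  ultimately show ?thesis by (smt (verit))
qed

section \<open>The double series\<close>

text \<open>The pole - \<theta> lies to the left of the strip, where |\<theta> + s| \<ge> \<theta>,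
  so the shift from the imaginary axis meets no obstacle.\<close>

lemma laplace_transform_eq_line_integral:
  assumes "0 < a" "1 < \<alpha>" "\<alpha> \<le> 2" "0 < q" "0 < \<theta>"
    and N: "real_distribution N"
    and char: "\<And>k. char N k = exp (of_real z * vline 0 k) * stable_laplace a \<alpha> (vline 0 k)"
  shows "of_real (\<integral>y. exp (- \<theta> * y) * indicator {0<..} y \<partial>N)
    = 1 / (2 * pi) * (CLBINT y. exp (of_real z * vline q y) * stable_laplace a \<alpha> (vline q y) / (of_real \<theta> + vline q y))"
proof -
  interpret real_distribution N by fact
  define g where "g s = exp (of_real z * s) * stable_laplace a \<alpha> s" for s
  define f where "f s = g s / (of_real \<theta> + s)" for s
  obtain C where C: "0 < C"
    "\<And>s. 0 \<le> Re s \<Longrightarrow> Re s \<le> q \<Longrightarrow> norm (stable_laplace a \<alpha> s) \<le> C * exp (- 1 * \<bar>Im s\<bar>)"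
    using stable_laplace_decay[of a \<alpha> q 1] assms by auto
  have nz: "of_real \<theta> + s \<noteq> 0" "\<theta> \<le> norm (of_real \<theta> + s)" if "0 \<le> Re s" for s
    using that assms complex_Re_le_cmod[of "of_real \<theta> + s"] by (auto simp: complex_eq_iff)
  have g: "norm (g s) \<le> exp (\<bar>z\<bar> * q) * C * exp (- \<bar>Im s\<bar>)" if "0 \<le> Re s" "Re s \<le> q" for s
  proof -
    have "z * Re s \<le> \<bar>z\<bar> * q" using that by (intro mult_mono) auto
    then have "norm (exp (of_real z * s)) \<le> exp (\<bar>z\<bar> * q)" by simp
    with C(2)[OF that] show ?thesis
      unfolding g_def norm_mult mult.assoc by (intro mult_mono) auto
  qed
  have cont_g: "continuous_on {s. 0 \<le> Re s} g"
    unfolding g_def using assms by (intro continuous_intros continuous_on_stable_laplace) auto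
  have "integrable lborel (char N)"
    using vertical_line_integrable[OF cont_g, of 0 "exp (\<bar>z\<bar> * q) * C"] g[of "vline 0 _"] assms
    by (simp add: char[abs_def] g_def)
  from laplace_transform_eq_integral_char[OF this \<open>0 < \<theta>\<close>]
  have "of_real (\<integral>y. exp (- \<theta> * y) * indicator {0<..} y \<partial>N) = 1 / (2 * pi) * (CLBINT y. f (vline 0 y))"
    by (simp add: char f_def g_def)
  also have "(CLBINT y. f (vline 0 y)) = (CLBINT y. f (vline q y))"
  proof (rule vertical_line_shift[where C = "exp (\<bar>z\<bar> * q) * C / \<theta>"])
    show "continuous_on {s. 0 \<le> Re s} f"
      unfolding f_def using nz by (intro continuous_intros cont_g) auto
    show "f holomorphic_on {s. 0 < Re s}"
      unfolding f_def g_def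
      by (intro holomorphic_intros holomorphic_on_stable_laplace) (use nz in force)
    show "norm (f s) \<le> exp (\<bar>z\<bar> * q) * C / \<theta> * exp (- \<bar>Im s\<bar>)" if "0 \<le> Re s" "Re s \<le> q" for s
    proof -
      have "norm (f s) \<le> (exp (\<bar>z\<bar> * q) * C * exp (- \<bar>Im s\<bar>)) / \<theta>"
        unfolding f_def norm_divide using g[OF that] nz[OF that(1)] assms
          order_trans[OF norm_ge_zero g[OF that]] by (intro frac_le) auto
      then show ?thesis by simp
    qed
  qed (use assms in auto)
  finally show ?thesis by (simp add: f_def g_def)
qed

context
  fixes a \<alpha> z :: real
  assumes params: "0 < a" "1 < \<alpha>" "\<alpha> \<le> 2"
begin

text \<open>The factor 1 / (2 pi) is that of the Hankel integral; 1 / q bounds the one factor 1 / s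
  left over when w^m is paired with s^(- m).\<close>

definition exp_majorant :: "real \<Rightarrow> nat \<Rightarrow> real" where
  "exp_majorant q n = 1 / (2 * pi * q) *
     (LBINT y. (\<bar>z\<bar> * norm (vline q y)) ^ n / fact n * norm (stable_laplace a \<alpha> (vline q y)))"

lemma power_laplace_integrable:
  assumes "0 < q"
  shows "integrable lborel (\<lambda>y. norm (vline q y) ^ n * norm (stable_laplace a \<alpha> (vline q y)))"
proof -
  have "vline q y \<noteq> 0" for y using assms by (auto simp: complex_eq_iff)
  then have "norm (vline q y) ^ n = norm (vline q y powr of_real (real n))" for y
    by (simp add: norm_power)
  then show ?thesis
    using integrable_norm[OF hankel_integrand_integrable[OF params assms, of "real n"]]
    by (simp only: norm_mult)
qed

lemma exp_majorant_integrable: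
  assumes "0 < q"
  shows "integrable lborel (\<lambda>y. (\<bar>z\<bar> * norm (vline q y)) ^ n / fact n * norm (stable_laplace a \<alpha> (vline q y)))"
  using integrable_mult_right[OF power_laplace_integrable[OF assms, of n], of "\<bar>z\<bar> ^ n / fact n"]
  by (simp add: power_mult_distrib mult_ac)

text \<open>The partial sums stay below the integral of exp (|z| |s|) times the stable factor, which
  is finite because the decay rate can be chosen above |z|.\<close>

lemma exp_majorant_summable:
  assumes "0 < q"
  shows "summable (exp_majorant q)"
proof (rule summableI_nonneg_bounded)
  let ?L = "\<lambda>y. norm (stable_laplace a \<alpha> (vline q y))"
  show "0 \<le> exp_majorant q n" for n using assms by (auto simp: exp_majorant_def)
  have E: "integrable lborel (\<lambda>y. exp (\<bar>z\<bar> * norm (vline q y)) * ?L y)"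
  proof -
    have "integrable lborel (\<lambda>y. of_real (exp (\<bar>z\<bar> * norm (vline q y))) * stable_laplace a \<alpha> (vline q y))"
    proof (rule stable_laplace_line_integrable[where B = "\<bar>z\<bar>" and K = "exp (\<bar>z\<bar> * q)"])
      fix y
      have "norm (vline q y) \<le> q + \<bar>y\<bar>" using cmod_le[of "vline q y"] assms by simp
      then have "\<bar>z\<bar> * norm (vline q y) \<le> \<bar>z\<bar> * q + \<bar>z\<bar> * \<bar>y\<bar>"
        by (metis abs_ge_zero distrib_left mult_left_mono)
      then show "norm (complex_of_real (exp (\<bar>z\<bar> * norm (vline q y)))) \<le> exp (\<bar>z\<bar> * q) * exp (\<bar>z\<bar> * \<bar>y\<bar>)"
        by (simp flip: exp_add)
    qed (use params assms in auto)
    from integrable_norm[OF this] show ?thesis by (simp add: norm_mult)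
  qed
  show "(\<Sum>n<k. exp_majorant q n) \<le> 1 / (2 * pi * q) * (LBINT y. exp (\<bar>z\<bar> * norm (vline q y)) * ?L y)" for k
  proof -
    have "(\<Sum>n<k. exp_majorant q n) = 1 / (2 * pi * q) * (LBINT y. (\<Sum>n<k. (\<bar>z\<bar> * norm (vline q y)) ^ n / fact n * ?L y))"
      unfolding exp_majorant_def sum_distrib_left[symmetric]
      by (subst Bochner_Integration.integral_sum) (use exp_majorant_integrable[OF assms] in auto)
    also have "\<dots> \<le> 1 / (2 * pi * q) * (LBINT y. exp (\<bar>z\<bar> * norm (vline q y)) * ?L y)"
    proof (intro mult_left_mono integral_mono)
      fix y
      have "(\<Sum>n<k. (\<bar>z\<bar> * norm (vline q y)) ^ n / fact n) \<le> exp (\<bar>z\<bar> * norm (vline q y))"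
        using sum_le_suminf[OF summable_exp_generic[of "\<bar>z\<bar> * norm (vline q y)"], of "{..<k}"]
        by (simp add: exp_def divide_inverse mult.commute)
      then show "(\<Sum>n<k. (\<bar>z\<bar> * norm (vline q y)) ^ n / fact n * ?L y) \<le> exp (\<bar>z\<bar> * norm (vline q y)) * ?L y"
        unfolding sum_distrib_right[symmetric] by (rule mult_right_mono) simp
    qed (use assms E exp_majorant_integrable[OF assms] in auto)
    finally show ?thesis .
  qed
qed

text \<open>Belongs to the double expansion of exp (z s) / (s - w) into z^n s^n / n! times w^m s^(-
  m - 1), hence \<beta> - 1 = n - m - 1. The Laplace transform uses w = - \<theta>, the option w =
  u.\<close>

definition call_coeff :: "real \<Rightarrow> nat \<Rightarrow> nat \<Rightarrow> real" where
  "call_coeff w n m = z ^ n / fact n * w ^ m * stable_coeff a \<alpha> (real n - real m)"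

text \<open>Applying |s| \<ge> q to the negative power s^(- m - 1) alone leaves a bound in which n
  and m separate.\<close>

lemma norm_line_powr_neg_le:
  assumes "0 < q"
  shows "norm (vline q y powr of_real (real n - real m - 1)) \<le> (1 / q) ^ m / q * norm (vline q y) ^ n"
proof -
  have nz: "vline q y \<noteq> 0" using assms by (auto simp: complex_eq_iff)
  have "norm (vline q y powr of_real (real n - real m - 1)) = norm (vline q y) powr (real n - real m - 1)"
    by (simp add: norm_powr_real_powr' del: of_real_diff)
  also have "\<dots> = norm (vline q y) powr (- real (Suc m)) * norm (vline q y) ^ n"
    using nz by (simp add: powr_realpow[symmetric] powr_add[symmetric] algebra_simps)
  also have "\<dots> \<le> q powr (- real (Suc m)) * norm (vline q y) ^ n"
    using assms complex_Re_le_cmod[of "vline q y"] by (intro mult_right_mono powr_mono2') auto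
  also have "q powr (- real (Suc m)) = (1 / q) ^ m / q"
    using assms by (simp add: powr_minus powr_realpow power_inverse divide_inverse del: of_nat_Suc)
  finally show ?thesis .
qed

lemma hankel_term_integral_le:
  assumes "0 < q"
  shows "\<bar>z\<bar> ^ n / fact n * (LBINT y. norm (vline q y powr of_real (real n - real m - 1) * stable_laplace a \<alpha> (vline q y)))
    \<le> 2 * pi * (1 / q) ^ m * exp_majorant q n"
proof -
  let ?L = "\<lambda>y. norm (stable_laplace a \<alpha> (vline q y))"
  have "\<bar>z\<bar> ^ n / fact n * (LBINT y. norm (vline q y powr of_real (real n - real m - 1) * stable_laplace a \<alpha> (vline q y)))
      \<le> \<bar>z\<bar> ^ n / fact n * (LBINT y. (1 / q) ^ m / q * (norm (vline q y) ^ n * ?L y))"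
  proof (intro mult_left_mono integral_mono)
    show "integrable lborel (\<lambda>y. norm (vline q y powr of_real (real n - real m - 1) * stable_laplace a \<alpha> (vline q y)))"
      by (intro integrable_norm hankel_integrand_integrable params assms)
    show "norm (vline q y powr of_real (real n - real m - 1) * stable_laplace a \<alpha> (vline q y))
        \<le> (1 / q) ^ m / q * (norm (vline q y) ^ n * ?L y)" for y
      using mult_right_mono[OF norm_line_powr_neg_le[OF assms, of y n m], of "?L y"]
      by (simp only: norm_mult mult.assoc norm_ge_zero simp_thms)
  qed (use power_laplace_integrable[OF assms] in auto)
  also have "\<dots> = 2 * pi * (1 / q) ^ m * exp_majorant q n"
  proof -
    have "exp_majorant q n = 1 / (2 * pi * q) * (\<bar>z\<bar> ^ n / fact n * (LBINT y. norm (vline q y) ^ n * ?L y))"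
      unfolding exp_majorant_def integral_mult_right_zero[symmetric] power_mult_distrib by (simp add: mult_ac)
    then show ?thesis using assms by (simp add: field_simps)
  qed
  finally show ?thesis .
qed

text \<open>Read off from the integral, which avoids growth estimates for 1 / Gamma. The left side
  does not depend on \<open>q\<close>, so q > |w| gives geometric decay in m.\<close>

lemma abs_call_coeff_le:
  assumes "0 < q"
  shows "\<bar>call_coeff w n m\<bar> \<le> exp_majorant q n * (\<bar>w\<bar> / q) ^ m"
proof -
  let ?I = "LBINT y. norm (vline q y powr of_real (real n - real m - 1) * stable_laplace a \<alpha> (vline q y))"
  have "\<bar>stable_coeff a \<alpha> (real n - real m)\<bar> = norm (hankel_integral a \<alpha> q (real n - real m))"
    unfolding hankel_integral_eq[OF params assms] by simp
  also have "\<dots> = 1 / (2 * pi) * norm (CLBINT y. vline q y powr of_real (real n - real m - 1) * stable_laplace a \<alpha> (vline q y))"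
    unfolding hankel_integral_def by (simp add: norm_mult norm_divide)
  also have "\<dots> \<le> 1 / (2 * pi) * ?I"
    by (intro mult_left_mono integral_norm_bound) simp
  finally have "\<bar>call_coeff w n m\<bar> \<le> \<bar>z\<bar> ^ n / fact n * \<bar>w\<bar> ^ m * (1 / (2 * pi) * ?I)"
    unfolding call_coeff_def abs_mult by (intro mult_mono) (auto simp: power_abs)
  also have "\<dots> = 1 / (2 * pi) * \<bar>w\<bar> ^ m * (\<bar>z\<bar> ^ n / fact n * ?I)" by (simp add: mult_ac)
  also have "\<dots> \<le> 1 / (2 * pi) * \<bar>w\<bar> ^ m * (2 * pi * (1 / q) ^ m * exp_majorant q n)"
    by (intro mult_left_mono hankel_term_integral_le assms) auto
  also have "\<dots> = exp_majorant q n * (\<bar>w\<bar> / q) ^ m"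
    by (simp add: power_divide)
  finally show ?thesis .
qed


lemma hankel_term_sums:
  assumes "0 < q"
  shows "(\<lambda>n. complex_of_real (call_coeff w n m)) sums
    (1 / (2 * pi) * (CLBINT y. of_real w ^ m * (vline q y powr of_real (- real m - 1) *
        (exp (of_real z * vline q y) * stable_laplace a \<alpha> (vline q y)))))"
proof -
  let ?G = "\<lambda>n y. vline q y powr of_real (real n - real m - 1) * stable_laplace a \<alpha> (vline q y)"
  define f where "f n y = of_real (w ^ m * (z ^ n / fact n)) * ?G n y" for n :: nat and y
  have nz: "vline q y \<noteq> 0" for y using assms by (auto simp: complex_eq_iff)
  have fsums: "(\<lambda>n. f n y) sums (of_real w ^ m * (vline q y powr of_real (- real m - 1) *
        (exp (of_real z * vline q y) * stable_laplace a \<alpha> (vline q y))))"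
    and fnorm: "summable (\<lambda>n. norm (f n y))" for y
  proof -
    let ?c = "of_real w ^ m * (vline q y powr of_real (- real m - 1) * stable_laplace a \<alpha> (vline q y))"
    have f_eq: "f n y = (of_real z * vline q y) ^ n /\<^sub>R fact n * ?c" for n
    proof -
      have "vline q y powr of_real (real n - real m - 1) = vline q y powr of_real (real n) * vline q y powr of_real (- real m - 1)"
      proof -
        have "real n - real m - 1 = real n + (- real m - 1)" by simp
        then show ?thesis by (simp only: of_real_add powr_add)
      qed
      also have "vline q y powr of_real (real n) = vline q y ^ n" using nz[of y] by simp
      finally have "vline q y powr of_real (real n - real m - 1) = vline q y ^ n * vline q y powr of_real (- real m - 1)" .
      then show ?thesis
        by (simp only: f_def power_mult_distrib scaleR_conv_of_real of_real_mult of_real_divide of_real_power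
            of_real_fact of_real_inverse divide_inverse mult_ac)
    qed
    have "(\<lambda>n. (of_real z * vline q y) ^ n /\<^sub>R fact n * ?c) sums (exp (of_real z * vline q y) * ?c)"
      by (intro sums_mult2 exp_converges)
    then show "(\<lambda>n. f n y) sums (of_real w ^ m * (vline q y powr of_real (- real m - 1) *
        (exp (of_real z * vline q y) * stable_laplace a \<alpha> (vline q y))))"
      unfolding f_eq by (simp only: mult_ac)
    show "summable (\<lambda>n. norm (f n y))"
      unfolding f_eq norm_mult[of _ ?c] by (intro summable_mult2 summable_norm_exp)
  qed
  have i: "integrable lborel (f n)" for n
    unfolding f_def by (intro integrable_mult_right hankel_integrand_integrable params assms)
  have s: "summable (\<lambda>n. \<integral>y. norm (f n y) \<partial>lborel)"
  proof (rule summable_comparison_test)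
    show "summable (\<lambda>n. \<bar>w\<bar> ^ m * (2 * pi * (1 / q) ^ m) * exp_majorant q n)"
      by (intro summable_mult exp_majorant_summable assms)
    have "norm (\<integral>y. norm (f n y) \<partial>lborel) \<le> \<bar>w\<bar> ^ m * (2 * pi * (1 / q) ^ m) * exp_majorant q n" for n
    proof -
      have "norm (\<integral>y. norm (f n y) \<partial>lborel) = (\<integral>y. norm (f n y) \<partial>lborel)" by simp
      also have "\<dots> = \<bar>w\<bar> ^ m * (\<bar>z\<bar> ^ n / fact n * (LBINT y. norm (?G n y)))"
        unfolding f_def norm_mult[of "of_real (w ^ m * (z ^ n / fact n))"] integral_mult_right_zero
        by (simp add: norm_mult norm_divide norm_power)
      also have "\<dots> \<le> \<bar>w\<bar> ^ m * (2 * pi * (1 / q) ^ m * exp_majorant q n)"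
        by (intro mult_left_mono hankel_term_integral_le assms) simp
      finally show ?thesis by (simp only: mult.assoc)
    qed
    then show "\<exists>N. \<forall>n\<ge>N. norm (\<integral>y. norm (f n y) \<partial>lborel) \<le> \<bar>w\<bar> ^ m * (2 * pi * (1 / q) ^ m) * exp_majorant q n"
      by blast
  qed
  have "(\<lambda>n. integral\<^sup>L lborel (f n)) sums (\<integral>y. (\<Sum>n. f n y) \<partial>lborel)"
    using fnorm by (intro sums_integral i s) auto
  then have "(\<lambda>n. 1 / (2 * pi) * integral\<^sup>L lborel (f n)) sums (1 / (2 * pi) * (\<integral>y. (\<Sum>n. f n y) \<partial>lborel))"
    by (rule sums_mult)
  moreover have "1 / (2 * pi) * integral\<^sup>L lborel (f n) = complex_of_real (call_coeff w n m)" for n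
  proof -
    have "1 / (2 * pi) * integral\<^sup>L lborel (f n)
        = of_real (w ^ m * (z ^ n / fact n)) * hankel_integral a \<alpha> q (real n - real m)"
      unfolding f_def hankel_integral_def integral_mult_right_zero by (simp only: mult_ac)
    then show ?thesis
      unfolding hankel_integral_eq[OF params assms] call_coeff_def by (simp only: of_real_mult mult_ac)
  qed
  ultimately show ?thesis
    unfolding sums_unique[OF fsums, symmetric] by (simp only:)
qed

text \<open>Here |w / s| \<le> |w| / q < 1 on the whole line, so the geometric series for 1 / (s -
  w) converges uniformly in y.\<close>

lemma line_integral_sums:
  assumes "\<bar>w\<bar> < q"
  shows "(\<lambda>m. complex_of_real (\<Sum>n. call_coeff w n m)) sums
    (1 / (2 * pi) * (CLBINT y. exp (of_real z * vline q y) * stable_laplace a \<alpha> (vline q y) / (- of_real w + vline q y)))"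
proof -
  have q: "0 < q" using assms by linarith
  define f where "f m y = of_real w ^ m * (vline q y powr of_real (- real m - 1) *
        (exp (of_real z * vline q y) * stable_laplace a \<alpha> (vline q y)))" for m :: nat and y
  define H where "H y = norm (exp (of_real z * vline q y) * stable_laplace a \<alpha> (vline q y))" for y
  have nz: "vline q y \<noteq> 0" "q \<le> norm (vline q y)" for y
    using q complex_Re_le_cmod[of "vline q y"] by (auto simp: complex_eq_iff)
  have f_eq: "f m y = (of_real w / vline q y) ^ m * (exp (of_real z * vline q y) * stable_laplace a \<alpha> (vline q y) / vline q y)"
    for m y
  proof -
    have "vline q y powr of_real (- real m - 1) = vline q y powr (- of_real (real (Suc m)))"
    proof -
      have "- real m - 1 = - real (Suc m)" by simp
      then show ?thesis by (simp only: of_real_minus)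
    qed
    also have "\<dots> = 1 / (vline q y ^ m * vline q y)"
      using nz(1)[of y] unfolding powr_minus of_real_of_nat_eq powr_complexpow[OF nz(1)[of y]]
      by (simp add: divide_inverse mult.commute)
    finally show ?thesis using nz(1)[of y] by (simp add: f_def power_divide)
  qed
  have wq: "norm (of_real w / vline q y) \<le> \<bar>w\<bar> / q" "norm (of_real w / vline q y) < 1" for y
  proof -
    show "norm (of_real w / vline q y) \<le> \<bar>w\<bar> / q"
      unfolding norm_divide using nz(2)[of y] q by (intro frac_le) auto
    also have "\<dots> < 1" using assms q by simp
    finally show "norm (of_real w / vline q y) < 1" .
  qed
  have fsums: "(\<lambda>m. f m y) sums (exp (of_real z * vline q y) * stable_laplace a \<alpha> (vline q y) / (- of_real w + vline q y))"
    and fnorm: "summable (\<lambda>m. norm (f m y))" for y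
  proof -
    let ?E = "exp (of_real z * vline q y) * stable_laplace a \<alpha> (vline q y)"
    have "(\<lambda>m. (of_real w / vline q y) ^ m * (?E / vline q y)) sums (1 / (1 - of_real w / vline q y) * (?E / vline q y))"
      using wq(2) by (intro sums_mult2 geometric_sums)
    also have "1 / (1 - of_real w / vline q y) * (?E / vline q y) = ?E / (- of_real w + vline q y)"
    proof -
      have "(1 - of_real w / vline q y) * vline q y = - of_real w + vline q y"
        using nz(1)[of y] by (simp add: left_diff_distrib)
      then show ?thesis by (metis times_divide_times_eq mult_1)
    qed
    finally show "(\<lambda>m. f m y) sums (?E / (- of_real w + vline q y))"
      unfolding f_eq .
    show "summable (\<lambda>m. norm (f m y))"
      unfolding f_eq norm_mult[of "_ ^ _"] norm_power
      using wq(2)[of y] by (intro summable_mult2 summable_geometric) simp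
  qed
  have H: "integrable lborel H"
    unfolding H_def
    by (intro integrable_norm stable_laplace_line_integrable[where B = 0 and K = "exp (z * q)"])
      (use params q in auto)
  have i: "integrable lborel (f m)" for m
  proof -
    have "integrable lborel (\<lambda>y. (of_real w ^ m * (vline q y powr of_real (- real m - 1) * exp (of_real z * vline q y)))
        * stable_laplace a \<alpha> (vline q y))"
    proof (rule stable_laplace_line_integrable[where B = "\<bar>- real m - 1\<bar>"
          and K = "\<bar>w\<bar> ^ m * (exp (z * q) * (q powr (- real m - 1) + exp (\<bar>- real m - 1\<bar> * q)))"])
      fix y
      have "norm (of_real w ^ m * (vline q y powr of_real (- real m - 1) * exp (of_real z * vline q y)))
          = \<bar>w\<bar> ^ m * (exp (z * q) * norm (vline q y powr of_real (- real m - 1)))"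
        by (simp add: norm_mult norm_power del: of_real_diff of_real_minus)
      also have "\<dots> \<le> \<bar>w\<bar> ^ m * (exp (z * q) * ((q powr (- real m - 1) + exp (\<bar>- real m - 1\<bar> * q)) * exp (\<bar>- real m - 1\<bar> * \<bar>y\<bar>)))"
        by (intro mult_left_mono norm_powr_line_le q) auto
      finally show "norm (of_real w ^ m * (vline q y powr of_real (- real m - 1) * exp (of_real z * vline q y)))
          \<le> \<bar>w\<bar> ^ m * (exp (z * q) * (q powr (- real m - 1) + exp (\<bar>- real m - 1\<bar> * q))) * exp (\<bar>- real m - 1\<bar> * \<bar>y\<bar>)"
        by (simp only: mult.assoc)
    next
      show "(\<lambda>y. of_real w ^ m * (vline q y powr of_real (- real m - 1) * exp (of_real z * vline q y))) \<in> borel_measurable borel"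
        by (intro borel_measurable_times vline_powr_measurable borel_measurable_const borel_measurable_continuous_onI continuous_intros)
    qed (use params q in auto)
    then show ?thesis by (simp only: f_def[abs_def] mult.assoc)
  qed
  have s: "summable (\<lambda>m. \<integral>y. norm (f m y) \<partial>lborel)"
  proof (rule summable_comparison_test)
    show "summable (\<lambda>m. (\<bar>w\<bar> / q) ^ m * (1 / q * integral\<^sup>L lborel H))"
      using assms q by (intro summable_mult2 summable_geometric) simp
    have "norm (\<integral>y. norm (f m y) \<partial>lborel) \<le> (\<bar>w\<bar> / q) ^ m * (1 / q * integral\<^sup>L lborel H)" for m
    proof -
      have "norm (\<integral>y. norm (f m y) \<partial>lborel) = (\<integral>y. norm (f m y) \<partial>lborel)" by simp
      also have "\<dots> \<le> (\<integral>y. (\<bar>w\<bar> / q) ^ m * (1 / q * H y) \<partial>lborel)"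
      proof (rule integral_mono)
        show "norm (f m y) \<le> (\<bar>w\<bar> / q) ^ m * (1 / q * H y)" for y
        proof -
          have "H y / norm (vline q y) \<le> H y / q"
            using nz(2)[of y] q by (intro divide_left_mono mult_pos_pos) (auto simp: H_def)
          then have "norm (of_real w / vline q y) ^ m * (H y / norm (vline q y)) \<le> (\<bar>w\<bar> / q) ^ m * (H y / q)"
            using wq(1)[of y] q by (intro mult_mono power_mono) (auto simp: H_def)
          then show ?thesis
            by (simp only: f_eq norm_mult[of "_ ^ _"] norm_power norm_divide[of _ "vline q y"] H_def mult_1 times_divide_eq_left)
        qed
      qed (use i H in auto)
      finally show ?thesis by simp
    qed
    then show "\<exists>N. \<forall>m\<ge>N. norm (\<integral>y. norm (f m y) \<partial>lborel) \<le> (\<bar>w\<bar> / q) ^ m * (1 / q * integral\<^sup>L lborel H)"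
      by blast
  qed
  have "(\<lambda>m. integral\<^sup>L lborel (f m)) sums (\<integral>y. (\<Sum>m. f m y) \<partial>lborel)"
    using fnorm by (intro sums_integral i s) auto
  then have "(\<lambda>m. 1 / (2 * pi) * integral\<^sup>L lborel (f m)) sums (1 / (2 * pi) * (\<integral>y. (\<Sum>m. f m y) \<partial>lborel))"
    by (rule sums_mult)
  moreover have "1 / (2 * pi) * integral\<^sup>L lborel (f m) = complex_of_real (\<Sum>n. call_coeff w n m)" for m
  proof -
    have h: "(\<lambda>n. complex_of_real (call_coeff w n m)) sums (1 / (2 * pi) * integral\<^sup>L lborel (f m))"
      using hankel_term_sums[OF q, of w m] by (simp only: f_def[abs_def])
    then have "summable (\<lambda>n. call_coeff w n m)"
      using sums_summable summable_of_real_iff by blast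
    then have "(\<lambda>n. complex_of_real (call_coeff w n m)) sums complex_of_real (\<Sum>n. call_coeff w n m)"
      by (intro sums_of_real summable_sums)
    with h show ?thesis by (rule sums_unique2)
  qed
  ultimately show ?thesis
    unfolding sums_unique[OF fsums, symmetric] by (simp only:)
qed

end

section \<open>Exchange of the two summations and passage to exponential moments\<close>

lemma double_series_swap:
  fixes t :: "nat \<Rightarrow> nat \<Rightarrow> real"
  assumes bnd: "\<And>n m. \<bar>t n m\<bar> \<le> v n * r ^ m" and "summable v" "0 \<le> r" "r < 1"
  shows "summable (t n)" "summable (\<lambda>n. t n m)" "(\<lambda>n. \<Sum>m. t n m) sums (\<Sum>m. \<Sum>n. t n m)"
    "summable (\<lambda>m. \<Sum>n. t n m)"
proof -
  have g: "summable (\<lambda>m. r ^ m)" using assms by (intro summable_geometric) simp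
  have row: "summable (\<lambda>m. \<bar>t n m\<bar>)" for n
    by (rule summable_comparison_test'[OF summable_mult[OF g, of "v n"]]) (use bnd in simp)
  have col: "summable (\<lambda>n. \<bar>t n m\<bar>)" for m
    by (rule summable_comparison_test'[OF summable_mult2[OF \<open>summable v\<close>, of "r ^ m"]]) (use bnd in simp)
  show "summable (t n)" "summable (\<lambda>n. t n m)"
    using row[of n] col[of m] by (auto intro: summable_rabs_cancel)
  \<comment> \<open>Sums over m are integrals for the counting measure, so the exchange becomes
    termwise integration.\<close>
  have i: "integrable (count_space UNIV) (t n)" for n
    using row by (simp add: integrable_count_space_nat_iff)
  have s: "summable (\<lambda>n. \<integral>m. norm (t n m) \<partial>count_space UNIV)"
  proof (rule summable_comparison_test')
    show "summable (\<lambda>n. v n * (\<Sum>m. r ^ m))" by (intro summable_mult2 assms)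
    fix n
    have "(\<integral>m. norm (t n m) \<partial>count_space UNIV) = (\<Sum>m. \<bar>t n m\<bar>)"
      using row by (subst integral_count_space_nat) (auto simp: integrable_count_space_nat_iff)
    also have "\<dots> \<le> (\<Sum>m. v n * r ^ m)"
      by (intro suminf_le bnd row summable_mult g)
    also have "\<dots> = v n * (\<Sum>m. r ^ m)" by (rule suminf_mult[OF g])
    finally show "norm (\<integral>m. norm (t n m) \<partial>count_space UNIV) \<le> v n * (\<Sum>m. r ^ m)" by simp
  qed
  have a: "AE m in count_space UNIV. summable (\<lambda>n. norm (t n m))" using col by simp
  have I: "integrable (count_space UNIV) (\<lambda>m. \<Sum>n. t n m)"
    by (rule integrable_suminf[OF i a s])
  then show "summable (\<lambda>m. \<Sum>n. t n m)"
    by (auto simp: integrable_count_space_nat_iff intro: summable_rabs_cancel)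
  from sums_integral[OF i a s]
  show "(\<lambda>n. \<Sum>m. t n m) sums (\<Sum>m. \<Sum>n. t n m)"
    by (simp only: integral_count_space_nat[OF i] integral_count_space_nat[OF I])
qed

text \<open>The line Re s = |w| + 1 gives the ratio |w| / (|w| + 1) < 1 whatever \<open>w\<close>
  is.\<close>

lemma abs_call_coeff_le_geometric:
  assumes "0 < a" "1 < \<alpha>" "\<alpha> \<le> 2"
  shows "\<exists>v r. summable v \<and> 0 \<le> r \<and> r < 1 \<and> (\<forall>n m. \<bar>call_coeff a \<alpha> z w n m\<bar> \<le> v n * r ^ m)"
  using exp_majorant_summable[OF assms, of "\<bar>w\<bar> + 1" z] abs_call_coeff_le[OF assms, of "\<bar>w\<bar> + 1" z w]
  by (intro exI[of _ "exp_majorant a \<alpha> z (\<bar>w\<bar> + 1)"] exI[of _ "\<bar>w\<bar> / (\<bar>w\<bar> + 1)"]) auto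

text \<open>The line integral yields moments only for w = - \<theta> < 0. Since w enters the
  coefficients through w^m alone, the same \<open>d m\<close> serve every w, and continuation
  reaches w = u.\<close>

lemma positive_exponential_moment:
  assumes params: "0 < a" "1 < \<alpha>" "\<alpha> \<le> 2"
    and N: "real_distribution N"
    and char: "\<And>k. char N k = exp (of_real z * vline 0 k) * stable_laplace a \<alpha> (vline 0 k)"
    and "0 \<le> u"
  shows "has_bochner_integral N (\<lambda>y. exp (u * y) * indicator {0<..} y) (\<Sum>m. \<Sum>n. call_coeff a \<alpha> z u n m)"
proof -
  define d where "d m = (\<Sum>n. call_coeff a \<alpha> z 1 n m)" for m
  have d: "(\<Sum>n. call_coeff a \<alpha> z w n m) = d m * w ^ m" for w m
  proof -
    obtain v r where "summable v" "0 \<le> r" "r < 1" "\<And>n m. \<bar>call_coeff a \<alpha> z 1 n m\<bar> \<le> v n * r ^ m"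
      using abs_call_coeff_le_geometric[OF params] by metis
    then have "summable (\<lambda>n. call_coeff a \<alpha> z 1 n m)" by (intro double_series_swap(2))
    from suminf_mult2[OF this, of "w ^ m"] show ?thesis
      unfolding d_def by (simp add: call_coeff_def[OF params] mult_ac)
  qed
  have "has_bochner_integral N (\<lambda>y. exp (u * y) * indicator {0<..} y) (\<Sum>m. d m * u ^ m)"
  proof (rule exponential_moment_continuation[OF N])
    show "summable (\<lambda>m. d m * w ^ m)" for w
    proof -
      obtain v r where "summable v" "0 \<le> r" "r < 1" "\<And>n m. \<bar>call_coeff a \<alpha> z w n m\<bar> \<le> v n * r ^ m"
        using abs_call_coeff_le_geometric[OF params] by metis
      then have "summable (\<lambda>m. \<Sum>n. call_coeff a \<alpha> z w n m)" by (intro double_series_swap(4))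
      then show ?thesis by (simp add: d)
    qed
    fix \<theta> :: real assume "0 < \<theta>"
    then have "(\<lambda>m. complex_of_real (\<Sum>n. call_coeff a \<alpha> z (- \<theta>) n m)) sums
        complex_of_real (\<integral>y. exp (- \<theta> * y) * indicator {0<..} y \<partial>N)"
      using line_integral_sums[OF params, of "- \<theta>" "\<theta> + 1" z]
        laplace_transform_eq_line_integral[OF params _ \<open>0 < \<theta>\<close> N char, of "\<theta> + 1"] by simp
    then show "(\<integral>y. exp (- \<theta> * y) * indicator {0<..} y \<partial>N) = (\<Sum>m. d m * (- \<theta>) ^ m)"
      unfolding sums_of_real_iff d by (rule sums_unique)
  qed fact
  then show ?thesis by (simp only: d)
qed

section \<open>Application to the stable process and the power call payoff\<close>

theorem mainTheorem7:
  fixes M :: "'a measure" and X :: "real \<Rightarrow> 'a \<Rightarrow> real"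
    and \<alpha> \<sigma> u S K r \<tau> \<mu> k\<^sub>u :: real
  assumes "1 < \<alpha>" and "\<alpha> \<le> 2" and "\<sigma> > 0" and "u > 0" and "S > 0" and "K > 0" and "\<tau> > 0"
    and "spectrally_negative_stable M X \<alpha> \<sigma>"
    and "\<mu> = \<sigma> powr \<alpha> / cos (pi * \<alpha> / 2)"
    and "k\<^sub>u = ln (S / K powr (1 / u)) + r * \<tau>"
  shows "integrable M (\<lambda>\<omega>. power_call_payoff u (asset_price X S r \<mu> \<tau> \<omega>) K)
    \<and> (\<forall>n. summable (\<lambda>m. power_call_term \<alpha> u \<mu> \<tau> k\<^sub>u n (Suc m)))
    \<and> summable (\<lambda>n. \<Sum>m. power_call_term \<alpha> u \<mu> \<tau> k\<^sub>u n (Suc m))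
    \<and> option_value M X (power_call_payoff u) S K r \<mu> \<tau> =
        K * exp (- r * \<tau>) / \<alpha> * (\<Sum>n. \<Sum>m. power_call_term \<alpha> u \<mu> \<tau> k\<^sub>u n (Suc m))"
proof -
  define a where "a = - \<mu> * \<tau>"
  define z where "z = k\<^sub>u + \<mu> * \<tau>"
  define C where "C = call_coeff a \<alpha> z u"
  define Y where "Y \<omega> = z + X \<tau> \<omega>" for \<omega>
  define N where "N = distr M borel Y"
  have cos_neg: "cos (pi * \<alpha> / 2) < 0"
  proof -
    have "pi * \<alpha> \<le> pi * 2" using assms by (intro mult_left_mono) auto
    then show ?thesis using cos_monotone_0_pi[of "pi / 2" "pi * \<alpha> / 2"] assms by (simp add: field_simps)
  qed
  then have params: "0 < a" "1 < \<alpha>" "\<alpha> \<le> 2"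
    using assms by (auto simp: a_def divide_pos_neg mult_neg_pos)
  have levy: "levy_process M X" and char_X: "char (distr M borel (X \<tau>)) k =
        exp (- complex_of_real (\<tau> * \<sigma> powr \<alpha> * \<bar>k\<bar> powr \<alpha>)
               * (1 + \<i> * complex_of_real (tan (\<alpha> * pi / 2) * sgn k)))" for k
    using assms(7,8) by (auto simp: spectrally_negative_stable_def)
  then have X[measurable]: "X \<tau> \<in> borel_measurable M" and M: "prob_space M"
    using assms(7) by (auto simp: levy_process_def)
  interpret M: prob_space M by (rule M)
  have Y[measurable]: "Y \<in> borel_measurable M" unfolding Y_def by measurable
  have N: "real_distribution N"
    unfolding N_def by (rule M.real_distribution_distr) (rule Y)

  have char_N: "char N k = exp (of_real z * vline 0 k) * stable_laplace a \<alpha> (vline 0 k)" for k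
  proof -
    have "char N k = (CLINT \<omega>|M. iexp (k * (z + X \<tau> \<omega>)))"
      unfolding N_def char_def by (subst integral_distr) (auto simp: Y_def)
    also have "\<dots> = (CLINT \<omega>|M. exp (of_real z * vline 0 k) * iexp (k * X \<tau> \<omega>))"
      by (intro Bochner_Integration.integral_cong) (simp_all add: algebra_simps flip: exp_add)
    also have "\<dots> = exp (of_real z * vline 0 k) * char (distr M borel (X \<tau>)) k"
      unfolding char_def by (subst integral_distr) auto
    also have "char (distr M borel (X \<tau>)) k = stable_laplace a \<alpha> (vline 0 k)"
    proof -
      have powr_i: "vline 0 k powr of_real \<alpha> = of_real (\<bar>k\<bar> powr \<alpha>) * cis (sgn k * (\<alpha> * pi / 2))"
      proof (cases "k = 0")
        case False
        then have eq: "vline 0 k = of_real \<bar>k\<bar> * (\<i> * of_real (sgn k))"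
          by (simp add: sgn_if)
        have "vline 0 k powr of_real \<alpha> = of_real \<bar>k\<bar> powr of_real \<alpha> * (\<i> * of_real (sgn k)) powr of_real \<alpha>"
          unfolding eq by (rule powr_of_real_mult_left) (use False in simp)
        also have "of_real \<bar>k\<bar> powr of_real \<alpha> = complex_of_real (\<bar>k\<bar> powr \<alpha>)"
          by (simp add: powr_of_real)
        also have "(\<i> * of_real (sgn k)) powr of_real \<alpha> = cis (sgn k * (\<alpha> * pi / 2))"
          using False by (cases "0 < k") (simp_all add: powr_def cis_conv_exp mult_ac)
        finally show ?thesis .
      qed simp
      \<comment> \<open>Factoring out the cosine, nonzero by \<open>cos_neg\<close>, exposes the
        factor 1 + \<i> tan (\<alpha> pi / 2) sgn k of the parametrization. At k = 0 this fails, but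
        there |k|^\<alpha> vanishes.\<close>
      have "cis (sgn k * (\<alpha> * pi / 2)) = of_real (cos (\<alpha> * pi / 2)) * (1 + \<i> * of_real (tan (\<alpha> * pi / 2) * sgn k))"
        if "k \<noteq> 0"
        using that cos_neg by (cases "0 < k") (auto simp: complex_eq_iff tan_def mult.commute)
      then have "of_real a * (vline 0 k powr of_real \<alpha>)
          = of_real (a * cos (\<alpha> * pi / 2)) * of_real (\<bar>k\<bar> powr \<alpha>) * (1 + \<i> * of_real (tan (\<alpha> * pi / 2) * sgn k))"
        unfolding powr_i by (cases "k = 0") simp_all
      also have "a * cos (\<alpha> * pi / 2) = - (\<tau> * \<sigma> powr \<alpha>)"
        using cos_neg by (simp add: a_def assms(9) mult.commute)
      finally show ?thesis
        unfolding char_X stable_laplace_def by simp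
    qed
    finally show ?thesis .
  qed

  have moment: "has_bochner_integral M (\<lambda>\<omega>. exp (w * Y \<omega>) * indicator {0<..} (Y \<omega>)) (\<Sum>m. \<Sum>n. call_coeff a \<alpha> z w n m)"
    if "0 \<le> w" for w
  proof -
    have "(\<lambda>y::real. exp (w * y) * indicator {0<..} y) \<in> borel_measurable borel" by measurable
    then show ?thesis
      using positive_exponential_moment[OF params N char_N that]
      by (simp add: has_bochner_integral_iff N_def integrable_distr_eq integral_distr)
  qed

  obtain v q where vq: "summable v" "0 \<le> q" "q < 1" "\<And>n m. \<bar>C n m\<bar> \<le> v n * q ^ m"
    using abs_call_coeff_le_geometric[OF params] unfolding C_def by metis
  note C = double_series_swap[OF vq(4,1,2,3)]
  \<comment> \<open>Leaving out m = 0 shifts the index; the extra factor \<open>q\<close> goes into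
    the majorant in n.\<close>
  have tail: "\<bar>C n (Suc m)\<bar> \<le> (v n * q) * q ^ m" for n m
    using vq(4)[of n "Suc m"] by (simp add: mult_ac)
  have "summable (\<lambda>n. v n * q)" by (intro summable_mult2 vq)
  note tail = double_series_swap[OF tail this vq(2,3)]
  \<comment> \<open>At w = 0 only m = 0 survives because 0^0 = 1, and the column m = 0 is the same
    for every w.\<close>
  have sum0: "(\<Sum>m. \<Sum>n. call_coeff a \<alpha> z 0 n m) = (\<Sum>n. C n 0)"
  proof -
    have "(\<Sum>m. \<Sum>n. call_coeff a \<alpha> z 0 n m) = (\<Sum>m\<in>{0}. \<Sum>n. call_coeff a \<alpha> z 0 n m)"
      by (rule suminf_finite) (auto simp: call_coeff_def[OF params] power_0_left)
    then show ?thesis by (simp add: call_coeff_def[OF params] C_def)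
  qed
  have "(\<Sum>m. \<Sum>n. C n m) - (\<Sum>n. C n 0) = (\<Sum>m. \<Sum>n. C n (Suc m))"
    using suminf_split_head[OF C(4)] by simp
  \<comment> \<open>The constant 1 of the payoff appears as exp (0 * Y), so that both parts are
    instances of \<open>moment\<close>.\<close>
  then have payoff_moment: "has_bochner_integral M
      (\<lambda>\<omega>. K * (exp (u * Y \<omega>) * indicator {0<..} (Y \<omega>) - exp (0 * Y \<omega>) * indicator {0<..} (Y \<omega>)))
      (K * (\<Sum>m. \<Sum>n. C n (Suc m)))"
    using has_bochner_integral_diff[OF moment[of u] moment[of 0]] assms(4)
    by (intro has_bochner_integral_mult_right) (simp add: sum0 C_def)
  \<comment> \<open>The division by K^(1/u) inside \<open>k\<^sub>u\<close> makes the u-th power of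
    the asset price equal to K exp (u Y); as K and u are positive, exercise happens exactly for Y >
    0.\<close>
  have payoff: "power_call_payoff u (asset_price X S r \<mu> \<tau> \<omega>) K
      = K * (exp (u * Y \<omega>) * indicator {0<..} (Y \<omega>) - exp (0 * Y \<omega>) * indicator {0<..} (Y \<omega>))" for \<omega>
  proof -
    have "asset_price X S r \<mu> \<tau> \<omega> powr u = K * exp (u * Y \<omega>)"
    proof -
      have "u * Y \<omega> = u * ln S - ln K + u * ((r + \<mu>) * \<tau> + X \<tau> \<omega>)"
      proof -
        have ku: "k\<^sub>u = ln S - ln K / u + r * \<tau>"
          using assms by (simp add: ln_div ln_powr)
        show ?thesis
          unfolding Y_def z_def ku using assms(4) by (simp add: algebra_simps)
      qed
      then have "K * exp (u * Y \<omega>) = exp (u * ln S + u * ((r + \<mu>) * \<tau> + X \<tau> \<omega>))"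
        using assms by (simp add: exp_add exp_diff)
      then show ?thesis
        using assms by (simp add: asset_price_def powr_def ln_mult distrib_left)
    qed
    then have "power_call_payoff u (asset_price X S r \<mu> \<tau> \<omega>) K
        = (K * (exp (u * Y \<omega>) - 1)) * indicator {0<..} (K * (exp (u * Y \<omega>) - 1))"
      by (simp add: power_call_payoff_def positive_part_def algebra_simps)
    also have "indicator {0<..} (K * (exp (u * Y \<omega>) - 1)) = (indicator {0<..} (Y \<omega>) :: real)"
      using assms by (simp add: indicator_def zero_less_mult_iff)
    finally show ?thesis by (simp add: algebra_simps)
  qed
  \<comment> \<open>The sign of n - m flips between the two notations, and the 1 / \<alpha> in front
    of the theorem's sum is the one contained in \<open>stable_coeff\<close>.\<close>
  have term_eq: "power_call_term \<alpha> u \<mu> \<tau> k\<^sub>u n m = \<alpha> * C n m" for n m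
  proof -
    have e: "(real m - real n) / \<alpha> = - (real n - real m) / \<alpha>" by simp
    have "power_call_term \<alpha> u \<mu> \<tau> k\<^sub>u n m
        = 1 / fact n * rGamma (1 - (real n - real m) / \<alpha>) * u ^ m * z ^ n * a powr (- (real n - real m) / \<alpha>)"
      unfolding power_call_term_def e z_def a_def by (simp only: minus_divide_left[symmetric] add_uminus_conv_diff)
    also have "\<dots> = \<alpha> * C n m"
      unfolding C_def call_coeff_def[OF params] stable_coeff_def using params by simp
    finally show ?thesis .
  qed
  have rows: "(\<Sum>m. power_call_term \<alpha> u \<mu> \<tau> k\<^sub>u n (Suc m)) = \<alpha> * (\<Sum>m. C n (Suc m))" for n
    unfolding term_eq by (rule suminf_mult[OF tail(1)])
  have total: "(\<lambda>n. \<Sum>m. power_call_term \<alpha> u \<mu> \<tau> k\<^sub>u n (Suc m)) sums (\<alpha> * (\<Sum>m. \<Sum>n. C n (Suc m)))"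
    unfolding rows by (intro sums_mult tail(3))
  \<comment> \<open>Integral and infinite sum are total operators, so the value equation alone would
    not assert that the expectation and the series exist; integrability and both summabilities
    do.\<close>
  show ?thesis
  proof (intro conjI allI)
    show "integrable M (\<lambda>\<omega>. power_call_payoff u (asset_price X S r \<mu> \<tau> \<omega>) K)"
      unfolding payoff using payoff_moment by (rule integrable.intros)
    show "summable (\<lambda>m. power_call_term \<alpha> u \<mu> \<tau> k\<^sub>u n (Suc m))" for n
      unfolding term_eq by (intro summable_mult tail(1))
    show "summable (\<lambda>n. \<Sum>m. power_call_term \<alpha> u \<mu> \<tau> k\<^sub>u n (Suc m))"
      using total by (rule sums_summable)
    show "option_value M X (power_call_payoff u) S K r \<mu> \<tau> =
        K * exp (- r * \<tau>) / \<alpha> * (\<Sum>n. \<Sum>m. power_call_term \<alpha> u \<mu> \<tau> k\<^sub>u n (Suc m))"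
      unfolding option_value_def payoff has_bochner_integral_integral_eq[OF payoff_moment]
        sums_unique[OF total, symmetric]
      using params by simp
  qed
qed

end
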